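(* Let $G$ and $H$ be finite graphs with $\chi_{v}(G) < \chi_{v}(H)$. Then $\rk(G \times H) \ge \rk(G)$, and equality holds if and only if every optimal vector coloring of $G \times H$ is induced by $G$.
   Context: For real $t \ge 1$, a vector $t$-coloring of a graph $G$ is an assignment $i \mapsto p_i$ of real vectors to the vertices with $p_i^Tp_i = t-1$ for all $i$ and $p_i^Tp_j \le -1$ whenever $i \sim j$. The vector chromatic number $\chi_{v}(G)$ is the least $t$ for which a vector $t$-coloring exists; a vector $\chi_v(G)$-coloring is called optimal. Vector colorings are identified when they have the same Gram matrix (i.e., differ by an isometry). The rank of a vector coloring $\mathbf{p}$ is $\dim \operatorname{span}\{p_i\}$ (the rank of its Gram matrix), and $\rk(G)$ denotes the maximum rank of an optimal vector coloring of $G$. The categorical product $G\times H$ has vertex set $V(G)\times V(H)$, with $(i,\ell)\sim(j,k)$ iff $i\sim j$ and $\ell\sim k$. A vector coloring of $G\times H$ is induced by $G$ if it is (up to isometry) of the form $(i,\ell)\mapsto p_i$ for some optimal vector coloring $\mathbf{p}$ of $G$; equivalently its Gram matrix is $M\otimes J$ where $M$ is the Gram matrix of an optimal vector coloring of $G$ and $J$ is the all-ones matrix indexed by $V(H)$. *)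

theory Defs
  imports
    Complex_Main
    "Graph_Theory.Pair_Digraph"
    "Jordan_Normal_Form.DL_Rank"
begin

(* A finite simple graph is a term G with pair_graph G: finite, loopless, and with a
   symmetric arc relation parcs G on the vertex set pverts G. *)

definition categorical_product ::
  "'a pair_pre_digraph \<Rightarrow> 'b pair_pre_digraph \<Rightarrow> ('a \<times> 'b) pair_pre_digraph" where
  "categorical_product G H =
     \<lparr> pverts = pverts G \<times> pverts H,
       parcs = {((i, l), (j, k)) | i l j k. (i, j) \<in> parcs G \<and> (l, k) \<in> parcs H} \<rparr>"

lemma pair_graph_categorical_product:
  assumes "pair_graph G" and "pair_graph H"
  shows "pair_graph (categorical_product G H)"
proof -
  interpret G: pair_graph G by fact
  interpret H: pair_graph H by fact
  let ?P = "categorical_product G H"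
  have arcs: "parcs ?P \<subseteq> pverts ?P \<times> pverts ?P"
    by (auto simp: categorical_product_def dest: G.in_arcsD1 G.in_arcsD2 H.in_arcsD1 H.in_arcsD2)
  have fin: "finite (pverts ?P)"
    by (simp add: categorical_product_def)
  have sym: "sym (parcs ?P)"
    using G.sym_arcs H.sym_arcs
    by (auto simp: categorical_product_def sym_def symmetric_def)
  show ?thesis
  proof
    show "finite (parcs ?P)"
      using arcs fin by (meson finite_SigmaI finite_subset)
    show "symmetric (with_proj ?P)"
      using sym by (simp add: symmetric_def)
  qed (use fin in \<open>auto simp: categorical_product_def
         dest: G.in_arcsD1 G.in_arcsD2 H.in_arcsD1 H.in_arcsD2 G.no_loops' H.no_loops'\<close>)
qed

(* Colorings by vectors of R^d. The dimension d is an argument because colorings in all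
   dimensions compete below; the values of p outside the vertex set are irrelevant. *)
definition vector_coloring ::
  "'a pair_pre_digraph \<Rightarrow> real \<Rightarrow> nat \<Rightarrow> ('a \<Rightarrow> real vec) \<Rightarrow> bool" where
  "vector_coloring G t d p \<longleftrightarrow>
     1 \<le> t \<and>
     (\<forall>i \<in> pverts G. p i \<in> carrier_vec d) \<and>
     (\<forall>i \<in> pverts G. p i \<bullet> p i = t - 1) \<and>
     (\<forall>(i, j) \<in> parcs G. p i \<bullet> p j \<le> - 1)"

definition vector_chromatic_number :: "'a pair_pre_digraph \<Rightarrow> real" where
  "vector_chromatic_number G = (LEAST t. \<exists>d p. vector_coloring G t d p)"

definition optimal_vector_coloring ::
  "'a pair_pre_digraph \<Rightarrow> nat \<Rightarrow> ('a \<Rightarrow> real vec) \<Rightarrow> bool" where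
  "optimal_vector_coloring G d p \<longleftrightarrow> vector_coloring G (vector_chromatic_number G) d p"

(* The dimension of span {p i | i a vertex} as a subspace of R^d. *)
definition coloring_rank ::
  "'a pair_pre_digraph \<Rightarrow> nat \<Rightarrow> ('a \<Rightarrow> real vec) \<Rightarrow> nat" where
  "coloring_rank G d p =
     vectorspace.dim class_ring
       (LinearCombinations.module.span_vs class_ring (module_vec TYPE(real) d) (p ` pverts G))"

lemma coloring_rank_eq_rank:
  assumes "\<forall>i \<in> pverts G. p i \<in> carrier_vec d" and "set vs = pverts G"
  shows "coloring_rank G d p = vec_space.rank d (mat_of_cols d (map p vs))"
proof -
  have "set (cols (mat_of_cols d (map p vs))) = p ` pverts G"
    using assms by (subst cols_mat_of_cols) auto
  then show ?thesis
    by (simp add: coloring_rank_def vec_space.rank_def)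
qed

definition max_coloring_rank :: "'a pair_pre_digraph \<Rightarrow> nat" where
  "max_coloring_rank G = Max {coloring_rank G d p | d p. optimal_vector_coloring G d p}"

(* The two colorings p and q, possibly in different dimensions, have the same Gram matrix,
   so they differ by an isometry. *)
definition same_Gram ::
  "'a pair_pre_digraph \<Rightarrow> ('a \<Rightarrow> real vec) \<Rightarrow> ('a \<Rightarrow> real vec) \<Rightarrow> bool" where
  "same_Gram G p q \<longleftrightarrow> (\<forall>i \<in> pverts G. \<forall>j \<in> pverts G. p i \<bullet> p j = q i \<bullet> q j)"

definition induced_by_left ::
  "'a pair_pre_digraph \<Rightarrow> 'b pair_pre_digraph \<Rightarrow> ('a \<times> 'b \<Rightarrow> real vec) \<Rightarrow> bool" where
  "induced_by_left G H q \<longleftrightarrow>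
     (\<exists>d p. optimal_vector_coloring G d p \<and>
        same_Gram (categorical_product G H) q (\<lambda>(i, l). p i))"

end

(* A vector t-coloring is a positive semidefinite kernel on the vertices with diagonal t - 1 and
   entries at most -1 on arcs. By projecting onto the cone of such kernels, a graph without one
   carries a certificate: a nonnegative weighted adjacency matrix A, normalised to have least
   eigenvalue at least -1 and with largest eigenvalue a > t - 1. Given
   certificates A, B of both factors, with largest eigenvalues a, b and c = max a b, the matrices
   (1 + A) (x) (1 + B) and (c - A) (x) (c - B) are positive semidefinite and c times the first plus
   the second is (c + 1) (c + A (x) B), so A (x) B is a certificate for the product. Hence the product
   has vector chromatic number chi_v(G).

   For the ranks, let p be an optimal coloring of G of maximal rank and q one of the product. The
   coloring (p_i, q_il) / sqrt 2 is optimal. If its rank does not exceed that of p, the projection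
   onto the first component is injective on its span, so that q_il does not depend on l. *)

theory Submission
  imports Defs "HOL-Analysis.Function_Topology"
begin

section \<open>Positive semidefinite kernels\<close>

definition quad :: "'a set \<Rightarrow> ('a \<Rightarrow> 'a \<Rightarrow> real) \<Rightarrow> ('a \<Rightarrow> real) \<Rightarrow> real" where
  "quad V M z = (\<Sum>i\<in>V. \<Sum>j\<in>V. z i * z j * M i j)"

text \<open>Symmetry is demanded explicitly because \<open>quad\<close> sees only the symmetric part
  of \<open>M\<close>. Kernels on a set replace matrices, so that product vertex sets need no
  enumeration.\<close>

definition psd_on :: "'a set \<Rightarrow> ('a \<Rightarrow> 'a \<Rightarrow> real) \<Rightarrow> bool" where
  "psd_on V M \<longleftrightarrow> (\<forall>i\<in>V. \<forall>j\<in>V. M i j = M j i) \<and> (\<forall>z. 0 \<le> quad V M z)"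

lemma psd_on_sym: "psd_on V M \<Longrightarrow> i \<in> V \<Longrightarrow> j \<in> V \<Longrightarrow> M i j = M j i"
  by (simp add: psd_on_def)

lemma psd_on_nonneg: "psd_on V M \<Longrightarrow> 0 \<le> quad V M z"
  by (simp add: psd_on_def)

lemma quad_add: "quad V (\<lambda>i j. M i j + N i j) z = quad V M z + quad V N z"
  by (simp add: quad_def distrib_left sum.distrib)

lemma quad_scale: "quad V (\<lambda>i j. c * M i j) z = c * quad V M z"
  by (simp add: quad_def sum_distrib_left mult_ac)

lemma quad_diag:
  assumes "finite V"
  shows "quad V (\<lambda>i j. if i = j then y i else 0) z = (\<Sum>i\<in>V. y i * (z i)\<^sup>2)"
  using assms by (simp add: quad_def if_distrib power2_eq_square mult_ac cong: if_cong)

lemma quad_gram: "quad V (\<lambda>i j. \<Sum>m\<in>I. x m i * x m j) z = (\<Sum>m\<in>I. (\<Sum>i\<in>V. z i * x m i)\<^sup>2)"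
proof -
  have "quad V (\<lambda>i j. \<Sum>m\<in>I. x m i * x m j) z
      = (\<Sum>i\<in>V. \<Sum>j\<in>V. \<Sum>m\<in>I. (z i * x m i) * (z j * x m j))"
    by (simp add: quad_def sum_distrib_left mult_ac)
  also have "\<dots> = (\<Sum>i\<in>V. \<Sum>m\<in>I. \<Sum>j\<in>V. (z i * x m i) * (z j * x m j))"
    by (intro sum.cong refl sum.swap)
  also have "\<dots> = (\<Sum>m\<in>I. \<Sum>i\<in>V. \<Sum>j\<in>V. (z i * x m i) * (z j * x m j))"
    by (rule sum.swap)
  finally show ?thesis
    by (simp add: power2_eq_square sum_product)
qed

lemma psd_on_gram: "psd_on V (\<lambda>i j. \<Sum>m\<in>I. x m i * x m j)"
  by (auto simp: psd_on_def quad_gram mult_ac intro: sum_nonneg)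

lemma psd_on_add: "psd_on V M \<Longrightarrow> psd_on V N \<Longrightarrow> psd_on V (\<lambda>i j. M i j + N i j)"
  by (simp add: psd_on_def quad_add)

lemma psd_on_scale: "psd_on V M \<Longrightarrow> 0 \<le> c \<Longrightarrow> psd_on V (\<lambda>i j. c * M i j)"
  by (simp add: psd_on_def quad_scale)

lemma psd_on_rank_one: "psd_on V (\<lambda>i j. z i * z j)"
  using psd_on_gram[where V = V and I = "{()}" and x = "\<lambda>_. z"] by simp

lemma psd_on_cong:
  "psd_on V M \<Longrightarrow> (\<And>i j. i \<in> V \<Longrightarrow> j \<in> V \<Longrightarrow> M i j = N i j) \<Longrightarrow> psd_on V N"
  by (simp add: psd_on_def quad_def)

lemma quad_insert:
  assumes "finite V" "a \<notin> V" and sym: "\<And>j. j \<in> V \<Longrightarrow> M j a = M a j"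
  shows "quad (insert a V) M z = (z a)\<^sup>2 * M a a + 2 * z a * (\<Sum>j\<in>V. z j * M a j) + quad V M z"
proof -
  have "(\<Sum>i\<in>V. z i * z a * M i a) = z a * (\<Sum>j\<in>V. z j * M a j)"
    by (simp add: sum_distrib_left sym mult_ac cong: sum.cong)
  moreover have "(\<Sum>j\<in>V. z a * z j * M a j) = z a * (\<Sum>j\<in>V. z j * M a j)"
    by (simp add: sum_distrib_left mult_ac)
  ultimately show ?thesis
    using assms(1,2) by (simp add: quad_def sum.distrib power2_eq_square)
qed

lemma quad_pair:
  assumes "finite V" "i \<in> V" "j \<in> V" "i \<noteq> j" "M i j = M j i"
  shows "quad V M (\<lambda>k. if k = i then a else if k = j then b else 0)
    = a\<^sup>2 * M i i + 2 * a * b * M i j + b\<^sup>2 * M j j"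
proof -
  let ?z = "\<lambda>k. if k = i then a else if k = j then b else 0"
  have *: "(\<Sum>k\<in>V. ?z k * f k) = a * f i + b * f j" for f
  proof -
    have "(\<Sum>k\<in>V. ?z k * f k) = (\<Sum>k\<in>{i, j}. ?z k * f k)"
      using assms by (intro sum.mono_neutral_right) auto
    then show ?thesis using assms by simp
  qed
  have "quad V M ?z = (\<Sum>k\<in>V. ?z k * (\<Sum>l\<in>V. ?z l * M k l))"
    by (simp add: quad_def sum_distrib_left mult_ac)
  then show ?thesis
    unfolding * using assms(5) by (simp add: power2_eq_square algebra_simps)
qed

lemma quad_single:
  assumes "finite V" "i \<in> V"
  shows "quad V M (\<lambda>k. if k = i then a else 0) = a\<^sup>2 * M i i"
proof -
  have *: "(\<Sum>k\<in>V. (if k = i then a else 0) * f k) = a * f i" for f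
    using assms sum.mono_neutral_right[of V "{i}" "\<lambda>k. (if k = i then a else 0) * f k"] by simp
  have "quad V M (\<lambda>k. if k = i then a else 0)
      = (\<Sum>k\<in>V. (if k = i then a else 0) * (\<Sum>l\<in>V. (if l = i then a else 0) * M k l))"
    by (simp add: quad_def sum_distrib_left mult_ac)
  then show ?thesis
    unfolding * by (simp add: power2_eq_square algebra_simps)
qed

lemma psd_on_diag_nonneg:
  assumes "finite V" "psd_on V M" "i \<in> V"
  shows "0 \<le> M i i"
  using psd_on_nonneg[OF assms(2)] quad_single[OF assms(1,3), of M 1] by (metis mult_1 one_power2)

lemma psd_on_pair:
  assumes "finite V" "psd_on V M" "i \<in> V" "j \<in> V" "i \<noteq> j"
  shows "0 \<le> a\<^sup>2 * M i i + 2 * a * b * M i j + b\<^sup>2 * M j j"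
  using psd_on_nonneg[OF assms(2)] quad_pair[where M = M, OF assms(1,3-5) psd_on_sym[OF assms(2-4)]]
  by metis

lemma psd_on_abs_le:
  assumes "finite V" "psd_on V M" "i \<in> V" "j \<in> V"
  shows "\<bar>M i j\<bar> \<le> (M i i + M j j) / 2"
proof (cases "i = j")
  case True
  then show ?thesis using psd_on_diag_nonneg[OF assms(1-3)] by simp
next
  case False
  show ?thesis
    using psd_on_pair[OF assms False, of 1 1] psd_on_pair[OF assms False, of 1 "-1"] by simp
qed

lemma psd_on_zero_diag:
  assumes "finite V" "psd_on V M" "i \<in> V" "j \<in> V" "M i i = 0"
  shows "M i j = 0"
proof (rule ccontr)
  assume nz: "M i j \<noteq> 0"
  with assms(5) have "i \<noteq> j" by auto
  \<comment> \<open>Since \<open>M i i = 0\<close>, the form is affine in \<open>c\<close> at the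
    vector with entry \<open>- c\<close> at \<open>i\<close> and 1 at \<open>j\<close>; this choice
    makes it -1.\<close>
  define c where "c = (M j j + 1) / (2 * M i j)"
  have "2 * c * M i j = M j j + 1"
    using nz by (simp add: c_def)
  then show False
    using psd_on_pair[OF assms(1-4) \<open>i \<noteq> j\<close>, of "- c" 1] assms(5) by simp
qed

text \<open>Cholesky factorization by induction on the vertices: eliminate the new vertex
  \<open>a\<close>, factor the Schur complement \<open>N\<close>, and append the normalised row of
  \<open>a\<close>. A zero pivot fits the same formulas: its row vanishes by
  \<open>psd_on_zero_diag\<close>, and division by zero yields 0.\<close>

lemma psd_on_imp_gram:
  assumes "finite V" "psd_on V M"
  shows "\<exists>(n::nat) x. \<forall>i\<in>V. \<forall>j\<in>V. M i j = (\<Sum>m<n. x m i * x m j)"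
  using assms
proof (induction V arbitrary: M rule: finite_induct)
  case empty
  then show ?case by simp
next
  case (insert a V)
  let ?W = "insert a V"
  have finW: "finite ?W" using insert.hyps by simp
  define N where "N i j = M i j - M a i * M a j / M a a" for i j
  have sym: "M j a = M a j" if "j \<in> V" for j
    using psd_on_sym[OF insert.prems, of j a] that by simp
  have zero: "M a j = 0" if "M a a = 0" "j \<in> V" for j
    using psd_on_zero_diag[OF finW insert.prems, of a j] that by simp
  have "psd_on V N"
    unfolding psd_on_def
  proof (intro conjI ballI allI)
    show "N i j = N j i" if "i \<in> V" "j \<in> V" for i j
      using psd_on_sym[OF insert.prems, of i j] that by (simp add: N_def)
  next
    fix z
    define s where "s = (\<Sum>j\<in>V. z j * M a j)"
    \<comment> \<open>The entry \<open>z' a\<close> minimises the form on \<open>insert a V\<close>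
      for fixed \<open>z\<close> on \<open>V\<close>; the minimum is the form of the Schur
      complement.\<close>
    define z' where "z' = z(a := - s / M a a)"
    have eq: "quad V M z' = quad V M z" "(\<Sum>j\<in>V. z' j * M a j) = s"
      using insert.hyps by (auto simp: quad_def z'_def s_def intro!: sum.cong)
    have "quad V N z = quad V M z - s\<^sup>2 / M a a"
    proof -
      have "quad V N z = quad V M z + quad V (\<lambda>i j. (- 1 / M a a) * (M a i * M a j)) z"
        by (subst quad_add[symmetric]) (simp add: N_def quad_def)
      also have "quad V (\<lambda>i j. (- 1 / M a a) * (M a i * M a j)) z = (- 1 / M a a) * s\<^sup>2"
        using quad_gram[where V = V and I = "{()}" and x = "\<lambda>_. M a" and z = z] by (simp only: quad_scale) (simp add: s_def)
      finally show ?thesis by simp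
    qed
    moreover have "quad ?W M z' = quad V M z - s\<^sup>2 / M a a"
    proof (cases "M a a = 0")
      case True
      then have "s = 0" by (auto simp: s_def zero)
      with True show ?thesis
        using insert.hyps by (subst quad_insert) (auto simp: sym eq)
    next
      case False
      moreover have "z' a = - s / M a a" by (simp add: z'_def)
      ultimately show ?thesis
        using insert.hyps
        by (subst quad_insert) (auto simp: sym eq power2_eq_square field_simps)
    qed
    ultimately show "0 \<le> quad V N z"
      using psd_on_nonneg[OF insert.prems, of z'] by simp
  qed
  from insert.IH[OF this] obtain n :: nat and x where
    x: "\<And>i j. i \<in> V \<Longrightarrow> j \<in> V \<Longrightarrow> N i j = (\<Sum>m<n. x m i * x m j)" by blast
  \<comment> \<open>Earlier rows are set to 0 at \<open>a\<close>, so every product involving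
    \<open>a\<close> comes from the new row \<open>n\<close> alone.\<close>
  define x' where "x' m i = (if m = n then M a i / sqrt (M a a) else if i = a then 0 else x m i)"
    for m :: nat and i
  have nonneg: "0 \<le> M a a"
    using psd_on_diag_nonneg[OF finW insert.prems, of a] by simp
  have last: "x' n i * x' n j = M a i * M a j / M a a" for i j
    using nonneg by (simp add: x'_def)
  have "M i j = (\<Sum>m<Suc n. x' m i * x' m j)" if "i \<in> ?W" "j \<in> ?W" for i j
  proof (cases "i = a \<or> j = a")
    case True
    then have "(\<Sum>m<n. x' m i * x' m j) = 0"
      by (auto simp: x'_def intro!: sum.neutral)
    moreover have "M a i * M a j / M a a = M i j"
    proof -
      have "M a k / M a a * M a a = M a k" "M a a * M a k / M a a = M a k" "M k a = M a k"
        if "k \<in> ?W" for k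
        using that zero[of k] sym[of k] by (cases "M a a = 0", auto)+
      with True that show ?thesis by (metis mult.commute)
    qed
    ultimately show ?thesis
      by (simp add: last)
  next
    case False
    then have V: "i \<in> V" "j \<in> V" "i \<noteq> a" "j \<noteq> a" using that by auto
    have "(\<Sum>m<n. x' m i * x' m j) = N i j"
      using False V by (simp add: x x'_def)
    then show ?thesis
      by (simp add: last N_def)
  qed
  then show ?case by blast
qed

section \<open>Positivity of tensor pairings\<close>

lemma sum_swap_pair:
  "(\<Sum>i\<in>A. \<Sum>j\<in>B. \<Sum>m\<in>C. F i j m) = (\<Sum>m\<in>C. \<Sum>i\<in>A. \<Sum>j\<in>B. F i j m)"
  for F :: "_ \<Rightarrow> _ \<Rightarrow> _ \<Rightarrow> real"
  by (simp only: sum.swap[where A = B and B = C]) (rule sum.swap)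

text \<open>With \<open>P\<close> factored as a Gram kernel, each pair \<open>r\<close>,
  \<open>m\<close> contributes the quadratic form of \<open>R\<close> at the vector whose entry at
  \<open>l\<close> is the sum of \<open>f r i * x m (i, l)\<close> over \<open>i\<close>.\<close>

lemma psd_on_tensor:
  assumes "finite V" "psd_on V P" "psd_on U R"
  shows "0 \<le> (\<Sum>i\<in>V. \<Sum>j\<in>V. \<Sum>l\<in>U. \<Sum>k\<in>U. P i j * R l k * (\<Sum>m\<in>I. x m (i, l) * x m (j, k)))"
proof -
  obtain n :: nat and f where f: "\<And>i j. i \<in> V \<Longrightarrow> j \<in> V \<Longrightarrow> P i j = (\<Sum>r<n. f r i * f r j)"
    using psd_on_imp_gram[OF assms(1,2)] by blast
  have "(\<Sum>i\<in>V. \<Sum>j\<in>V. \<Sum>l\<in>U. \<Sum>k\<in>U. P i j * R l k * (\<Sum>m\<in>I. x m (i, l) * x m (j, k)))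
     = (\<Sum>i\<in>V. \<Sum>j\<in>V. \<Sum>l\<in>U. \<Sum>k\<in>U. \<Sum>r<n. \<Sum>m\<in>I. R l k * (f r i * x m (i, l)) * (f r j * x m (j, k)))"
    by (intro sum.cong refl) (simp add: f sum_distrib_left sum_distrib_right mult_ac)
  also have "\<dots> = (\<Sum>r<n. \<Sum>m\<in>I. \<Sum>l\<in>U. \<Sum>k\<in>U. \<Sum>i\<in>V. \<Sum>j\<in>V. R l k * (f r i * x m (i, l)) * (f r j * x m (j, k)))"
    by (simp only: sum_swap_pair[where A = U and B = U and C = "{..<n}"]
        sum_swap_pair[where A = U and B = U and C = I]
        sum_swap_pair[where A = V and B = V and C = "{..<n}"]
        sum_swap_pair[where A = V and B = V and C = I]
        sum_swap_pair[where A = V and B = V and C = U])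
  also have "\<dots> = (\<Sum>r<n. \<Sum>m\<in>I. quad U R (\<lambda>l. \<Sum>i\<in>V. f r i * x m (i, l)))"
    unfolding quad_def sum_product sum_distrib_right
    by (intro sum.cong refl) (simp add: sum_distrib_left mult_ac)
  also have "\<dots> \<ge> 0"
    by (intro sum_nonneg psd_on_nonneg assms(3))
  finally show ?thesis .
qed

section \<open>Dual certificates\<close>

text \<open>Coercivity restricts the search to diagonals at most \<open>K\<close>. By
  \<open>psd_on_abs_le\<close> all entries are then at most \<open>K\<close> in absolute value, and
  a continuous function attains its minimum on this compact set.\<close>

lemma psd_on_attains_inf:
  fixes F :: "('a \<Rightarrow> 'a \<Rightarrow> real) \<Rightarrow> real"
  assumes "finite V"
    and cont: "continuous_on UNIV (\<lambda>m. F (\<lambda>i j. m (i, j)))"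
    and cong: "\<And>M N. (\<And>i j. i \<in> V \<Longrightarrow> j \<in> V \<Longrightarrow> M i j = N i j) \<Longrightarrow> F M = F N"
    and coercive: "\<And>M i. psd_on V M \<Longrightarrow> i \<in> V \<Longrightarrow> K < M i i \<Longrightarrow> F (\<lambda>_ _. 0) \<le> F M"
    and "0 \<le> K"
  shows "\<exists>M. psd_on V M \<and> (\<forall>N. psd_on V N \<longrightarrow> F M \<le> F N)"
proof -
  \<comment> \<open>Coordinates outside \<open>V \<times> V\<close> are pinned to 0, so that the box
    is compact by Tychonoff even over an infinite vertex type.\<close>
  define C where "C e = (if e \<in> V \<times> V then {- K..K} else {0})" for e
  define S where "S = PiE UNIV C \<inter> {m. psd_on V (\<lambda>i j. m (i, j))}"
  have "compactin euclidean (PiE UNIV C)"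
    unfolding euclidean_product_topology[symmetric] compactin_PiE
    by (auto simp: C_def)
  then have "compact (PiE UNIV C)"
    by simp
  moreover have "closed {m :: 'a \<times> 'a \<Rightarrow> real. psd_on V (\<lambda>i j. m (i, j))}"
    unfolding psd_on_def quad_def Ball_def
    by (intro closed_Collect_conj closed_Collect_all closed_Collect_imp closed_Collect_eq
        closed_Collect_le open_Collect_const continuous_intros continuous_on_product_coordinates)
  ultimately have "compact S"
    unfolding S_def by (rule compact_Int_closed)
  have zero: "psd_on V (\<lambda>_ _. 0)"
    by (simp add: psd_on_def quad_def)
  then have "(\<lambda>_. 0) \<in> S"
    using \<open>0 \<le> K\<close> by (simp add: S_def C_def PiE_def)
  then obtain m where m: "m \<in> S" "\<And>n. n \<in> S \<Longrightarrow> F (\<lambda>i j. m (i, j)) \<le> F (\<lambda>i j. n (i, j))"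
    using continuous_attains_inf[OF \<open>compact S\<close> _ continuous_on_subset[OF cont]] by blast
  have "F (\<lambda>i j. m (i, j)) \<le> F N" if N: "psd_on V N" for N
  proof (cases "\<forall>i\<in>V. N i i \<le> K")
    case True
    define n where "n e = (if e \<in> V \<times> V then N (fst e) (snd e) else 0)" for e
    have "\<bar>N i j\<bar> \<le> K" if "i \<in> V" "j \<in> V" for i j
      using psd_on_abs_le[OF assms(1) N that] bspec[OF True that(1)] bspec[OF True that(2)] by simp
    then have "n \<in> PiE UNIV C"
      by (auto simp: PiE_def C_def n_def abs_le_iff minus_le_iff)
    moreover have "psd_on V (\<lambda>i j. n (i, j))"
      by (rule psd_on_cong[OF N]) (simp add: n_def)
    ultimately have "F (\<lambda>i j. m (i, j)) \<le> F (\<lambda>i j. n (i, j))"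
      by (intro m(2)) (simp add: S_def)
    also have "\<dots> = F N"
      by (rule cong) (simp add: n_def)
    finally show ?thesis .
  next
    case False
    then have "F (\<lambda>_ _. 0) \<le> F N"
      using coercive[OF N] by fastforce
    with m(2)[OF \<open>(\<lambda>_. 0) \<in> S\<close>] show ?thesis by simp
  qed
  moreover have "psd_on V (\<lambda>i j. m (i, j))"
    using m(1) by (simp add: S_def)
  ultimately show ?thesis by blast
qed

text \<open>The Gram matrix of a vector coloring, with \<open>s\<close> for t - 1: the dimension
  disappears and the feasible set is convex.\<close>

definition gram_coloring ::
  "'a set \<Rightarrow> ('a \<times> 'a) set \<Rightarrow> real \<Rightarrow> ('a \<Rightarrow> 'a \<Rightarrow> real) \<Rightarrow> bool" where
  "gram_coloring V E s M \<longleftrightarrow>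
     psd_on V M \<and> (\<forall>i\<in>V. M i i = s) \<and> (\<forall>(i, j)\<in>E. M i j \<le> - 1)"

text \<open>Here \<open>y\<close> and \<open>w\<close> are multipliers of the diagonal and the arc
  constraints; pairing with a Gram coloring at level \<open>s\<close> contradicts the last
  inequality. For positive \<open>y\<close>, scaling rows and columns of \<open>w\<close> by
  \<open>1 / sqrt (y i)\<close> gives a matrix with least eigenvalue at least -1; keeping
  \<open>y\<close> avoids dividing by zero weights.\<close>

definition dual_certificate ::
  "'a set \<Rightarrow> ('a \<times> 'a) set \<Rightarrow> real \<Rightarrow> ('a \<Rightarrow> real) \<Rightarrow> ('a \<Rightarrow> 'a \<Rightarrow> real) \<Rightarrow> bool" where
  "dual_certificate V E s y w \<longleftrightarrow>
     (\<forall>i j. 0 \<le> w i j \<and> ((i, j) \<notin> E \<longrightarrow> w i j = 0)) \<and>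
     psd_on V (\<lambda>i j. (if i = j then y i else 0) + w i j) \<and>
     s * (\<Sum>i\<in>V. y i) < (\<Sum>i\<in>V. \<Sum>j\<in>V. w i j)"

text \<open>The first-order condition at a minimum along a segment: for small steps \<open>e\<close>
  the linear term dominates.\<close>

lemma nonneg_of_eps:
  fixes a C :: real
  assumes "\<And>e. 0 < e \<Longrightarrow> e \<le> 1 \<Longrightarrow> 0 \<le> e * a + e\<^sup>2 * C"
  shows "0 \<le> a"
proof (rule ccontr)
  assume "\<not> 0 \<le> a"
  \<comment> \<open>The second bound makes \<open>e * C\<close> at most \<open>- a / 2\<close>, so
    \<open>a + e * C\<close> stays negative.\<close>
  define e where "e = min 1 (- a / (2 * (\<bar>C\<bar> + 1)))"
  have e: "0 < e" "e \<le> 1" "e \<le> - a / (2 * (\<bar>C\<bar> + 1))"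
    using \<open>\<not> 0 \<le> a\<close> by (simp_all add: e_def divide_less_0_iff)
  have "e * C \<le> e * (\<bar>C\<bar> + 1)"
    using e by (intro mult_left_mono) auto
  also have "\<dots> \<le> - a / 2"
    using e(3) by (simp add: field_simps)
  finally have "a + e * C < 0"
    using \<open>\<not> 0 \<le> a\<close> by simp
  then have "e * (a + e * C) < 0"
    using e(1) by (simp add: mult_less_0_iff)
  with assms[OF e(1,2)] show False
    by (simp add: power2_eq_square algebra_simps)
qed

text \<open>A second-order upper bound for \<open>(max 0 x)\<^sup>2\<close>, whose derivative is
  \<open>2 * max 0 x\<close>. It follows from
  \<open>max 0 (x + h) \<le> \<bar>max 0 x + h\<bar>\<close>.\<close>

lemma pos_part_sq_le:
  fixes x h :: real
  shows "(max 0 (x + h))\<^sup>2 \<le> (max 0 x)\<^sup>2 + 2 * max 0 x * h + h\<^sup>2"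
proof -
  have "(max 0 (x + h))\<^sup>2 \<le> (max 0 x + h)\<^sup>2"
    unfolding abs_le_square_iff[symmetric] by (auto simp: max_def)
  then show ?thesis by (simp add: power2_sum algebra_simps)
qed

text \<open>If no coloring exists, the certificate is the gradient of the squared
  distance \<open>F\<close> to feasibility at a nearest positive semidefinite kernel.\<close>

lemma gram_coloring_or_certificate:
  assumes "finite V" "E \<subseteq> V \<times> V" "sym E" "0 \<le> s"
  shows "(\<exists>M. gram_coloring V E s M) \<or> (\<exists>y w. dual_certificate V E s y w)"
proof -
  define e :: "'a \<Rightarrow> 'a \<Rightarrow> real" where "e i j = (if (i, j) \<in> E then 1 else 0)" for i j
  define F where "F M = (\<Sum>i\<in>V. (M i i - s)\<^sup>2) + (\<Sum>i\<in>V. \<Sum>j\<in>V. e i j * (max 0 (M i j + 1))\<^sup>2)" for M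
  have e_nonneg: "0 \<le> e i j" for i j by (simp add: e_def)
  \<comment> \<open>A diagonal entry above \<open>K\<close> alone contributes at least the square of
    \<open>F (\<lambda>_ _. 0) + 1\<close>, so such a kernel is no better than 0.\<close>
  define K where "K = s + F (\<lambda>_ _. 0) + 1"
  have F_nonneg: "0 \<le> F M" for M
    by (auto simp: F_def e_nonneg intro!: add_nonneg_nonneg sum_nonneg)
  have "\<exists>M. psd_on V M \<and> (\<forall>N. psd_on V N \<longrightarrow> F M \<le> F N)"
  proof (rule psd_on_attains_inf[where K = K, OF assms(1)])
    show "continuous_on UNIV (\<lambda>m. F (\<lambda>i j. m (i, j)))"
      unfolding F_def by (intro continuous_intros continuous_on_max continuous_on_product_coordinates)
    show "F M = F N" if "\<And>i j. i \<in> V \<Longrightarrow> j \<in> V \<Longrightarrow> M i j = N i j" for M N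
      by (simp add: F_def that cong: sum.cong)
    show "0 \<le> K" using F_nonneg[of "\<lambda>_ _. 0"] assms(4) by (simp add: K_def)
    show "F (\<lambda>_ _. 0) \<le> F M" if "i \<in> V" "K < M i i" for M i
    proof -
      let ?c = "F (\<lambda>_ _. 0) + 1"
      have "F (\<lambda>_ _. 0) \<le> ?c * ?c"
        using F_nonneg[of "\<lambda>_ _. 0"] by (simp add: algebra_simps)
      also have "\<dots> \<le> (M i i - s)\<^sup>2"
        unfolding power2_eq_square
        using that(2) F_nonneg[of "\<lambda>_ _. 0"] by (intro mult_mono) (auto simp: K_def)
      also have "\<dots> \<le> (\<Sum>i\<in>V. (M i i - s)\<^sup>2)"
        using that(1) assms(1) by (intro member_le_sum) auto
      also have "\<dots> \<le> F M"
        by (auto simp: F_def e_nonneg intro!: sum_nonneg)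
      finally show ?thesis .
    qed
  qed
  then obtain M where M: "psd_on V M" and min: "\<And>N. psd_on V N \<Longrightarrow> F M \<le> F N" by blast
  define y where "y i = 2 * (M i i - s)" for i
  define w where "w i j = (if i \<in> V \<and> j \<in> V then 2 * e i j * max 0 (M i j + 1) else 0)" for i j
  \<comment> \<open>\<open>L D\<close> is the derivative of \<open>F\<close> at \<open>M\<close> in
    direction \<open>D\<close>. Minimality makes it nonnegative whenever steps up to 1 along
    \<open>D\<close> stay in the cone.\<close>
  define L where "L D = (\<Sum>i\<in>V. y i * D i i) + (\<Sum>i\<in>V. \<Sum>j\<in>V. w i j * D i j)" for D
  have L_nonneg: "0 \<le> L D"
    if D: "\<And>c. 0 < c \<Longrightarrow> c \<le> 1 \<Longrightarrow> psd_on V (\<lambda>i j. M i j + c * D i j)" for D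
  proof (rule nonneg_of_eps)
    let ?C = "(\<Sum>i\<in>V. (D i i)\<^sup>2) + (\<Sum>i\<in>V. \<Sum>j\<in>V. e i j * (D i j)\<^sup>2)"
    fix c :: real assume c: "0 < c" "c \<le> 1"
    have "F M \<le> F (\<lambda>i j. M i j + c * D i j)"
      by (rule min[OF D[OF c]])
    also have "\<dots> \<le> (\<Sum>i\<in>V. (M i i - s)\<^sup>2 + c * (y i * D i i) + c\<^sup>2 * (D i i)\<^sup>2) +
      (\<Sum>i\<in>V. \<Sum>j\<in>V. e i j * (max 0 (M i j + 1))\<^sup>2 + c * (w i j * D i j) + c\<^sup>2 * (e i j * (D i j)\<^sup>2))"
      unfolding F_def
    proof (intro add_mono sum_mono)
      fix i j assume "i \<in> V" "j \<in> V"
      then show "e i j * (max 0 (M i j + c * D i j + 1))\<^sup>2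
        \<le> e i j * (max 0 (M i j + 1))\<^sup>2 + c * (w i j * D i j) + c\<^sup>2 * (e i j * (D i j)\<^sup>2)"
        using mult_left_mono[OF pos_part_sq_le[of "M i j + 1" "c * D i j"] e_nonneg[of i j]]
        by (simp add: w_def power_mult_distrib algebra_simps)
    qed (simp add: y_def power2_eq_square algebra_simps)
    also have "\<dots> = F M + (c * L D + c\<^sup>2 * ?C)"
      by (simp add: F_def L_def sum.distrib sum_distrib_left distrib_left)
    finally show "0 \<le> c * L D + c\<^sup>2 * ?C" by simp
  qed
  show ?thesis
  proof (cases "F M = 0")
    case True
    have A: "0 \<le> (\<Sum>i\<in>V. (M i i - s)\<^sup>2)" "0 \<le> (\<Sum>i\<in>V. \<Sum>j\<in>V. e i j * (max 0 (M i j + 1))\<^sup>2)"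
      by (auto intro!: sum_nonneg simp: e_nonneg)
    then have "(\<Sum>i\<in>V. (M i i - s)\<^sup>2) = 0" "(\<Sum>i\<in>V. \<Sum>j\<in>V. e i j * (max 0 (M i j + 1))\<^sup>2) = 0"
      using True unfolding F_def by linarith+
    then have "\<forall>i\<in>V. (M i i - s)\<^sup>2 = 0" "\<forall>i\<in>V. \<forall>j\<in>V. e i j * (max 0 (M i j + 1))\<^sup>2 = 0"
      using assms(1) by (simp_all add: sum_nonneg_eq_0_iff e_nonneg sum_nonneg)
    then have "gram_coloring V E s M"
      using M assms(2) by (fastforce simp: gram_coloring_def e_def max_def split: if_splits)
    then show ?thesis by blast
  next
    case False
    then have "0 < F M" using F_nonneg[of M] by simp
    have Lz: "L (\<lambda>i j. z i * z j) = quad V (\<lambda>i j. (if i = j then y i else 0) + w i j) z" for z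
      unfolding quad_add quad_diag[OF assms(1)]
      by (simp add: L_def quad_def power2_eq_square mult_ac)
    \<comment> \<open>Rank-one directions stay in the cone, and on them \<open>L\<close> is the
      quadratic form of the certificate.\<close>
    have "0 \<le> L (\<lambda>i j. z i * z j)" for z
      by (intro L_nonneg psd_on_add[OF M] psd_on_scale psd_on_rank_one) simp
    then have "psd_on V (\<lambda>i j. (if i = j then y i else 0) + w i j)"
      using psd_on_sym[OF M] assms(3)
      by (auto simp: psd_on_def Lz w_def e_def dest: symD)
    \<comment> \<open>Shrinking \<open>M\<close> towards 0 stays in the cone, so \<open>L M\<close>
      is at most 0. Expanding squares, \<open>L M\<close> equals \<open>s\<close> times the sum of
      \<open>y\<close>, minus the sum of \<open>w\<close>, plus \<open>2 * F M\<close>; as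
      \<open>F M\<close> is positive, the last clause of the certificate is strict.\<close>
    moreover have "0 \<le> L (\<lambda>i j. - M i j)"
    proof (rule L_nonneg)
      fix c :: real assume "0 < c" "c \<le> 1"
      then show "psd_on V (\<lambda>i j. M i j + c * - M i j)"
        using psd_on_scale[OF M, of "1 - c"] by (simp add: algebra_simps)
    qed
    moreover have "s * (\<Sum>i\<in>V. y i) - (\<Sum>i\<in>V. \<Sum>j\<in>V. w i j) = - L (\<lambda>i j. - M i j) - 2 * F M"
    proof -
      have a: "(\<Sum>i\<in>V. y i * M i i) = s * (\<Sum>i\<in>V. y i) + 2 * (\<Sum>i\<in>V. (M i i - s)\<^sup>2)"
        unfolding sum_distrib_left sum.distrib[symmetric]
        by (intro sum.cong refl) (simp add: y_def power2_eq_square algebra_simps)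
      have "w i j * M i j = 2 * (e i j * (max 0 (M i j + 1))\<^sup>2) - w i j" if "i \<in> V" "j \<in> V" for i j
        using that by (simp add: w_def max_def power2_eq_square algebra_simps)
      then have b: "(\<Sum>i\<in>V. \<Sum>j\<in>V. w i j * M i j)
        = 2 * (\<Sum>i\<in>V. \<Sum>j\<in>V. e i j * (max 0 (M i j + 1))\<^sup>2) - (\<Sum>i\<in>V. \<Sum>j\<in>V. w i j)"
        unfolding sum_distrib_left sum_subtractf[symmetric] by (intro sum.cong refl)
      show ?thesis
        by (simp add: L_def F_def sum_negf a b)
    qed
    ultimately have "dual_certificate V E s y w"
      using \<open>0 < F M\<close> by (auto simp: dual_certificate_def w_def e_def)
    then show ?thesis by blast
  qed
qed

section \<open>The product of two certificates\<close>

abbreviation diag :: "('a \<Rightarrow> real) \<Rightarrow> 'a \<Rightarrow> 'a \<Rightarrow> real" where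
  "diag y \<equiv> \<lambda>i j. if i = j then y i else 0"

text \<open>Testing positivity on the two entries \<open>u i\<close> and \<open>- u j\<close> bounds
  each summand by a mean of two diagonal terms. The crude factor \<open>card V\<close> shows that
  the largest relative eigenvalue is finite and excludes certificates at level
  \<open>card V\<close>.\<close>

lemma dual_certificate_bound:
  assumes "finite V" "\<And>i. (i, i) \<notin> E" "dual_certificate V E s y w"
  shows "quad V w u \<le> real (card V) * (\<Sum>i\<in>V. y i * (u i)\<^sup>2)"
proof -
  have psd: "psd_on V (\<lambda>i j. diag y i j + w i j)" and w0: "w i i = 0" for i
    using assms(2,3) by (auto simp: dual_certificate_def)
  have y0: "0 \<le> y i" if "i \<in> V" for i
    using psd_on_diag_nonneg[OF assms(1) psd that] by (simp add: w0)
  have "u i * u j * w i j \<le> (y i * (u i)\<^sup>2 + y j * (u j)\<^sup>2) / 2" if ij: "i \<in> V" "j \<in> V" for i j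
  proof (cases "i = j")
    case True
    then show ?thesis using y0[OF ij(1)] by (simp add: w0)
  next
    case False
    then show ?thesis
      using psd_on_pair[OF assms(1) psd ij False, of "u i" "- u j"] by (simp add: w0 mult_ac)
  qed
  then have "quad V w u \<le> (\<Sum>i\<in>V. \<Sum>j\<in>V. (y i * (u i)\<^sup>2 + y j * (u j)\<^sup>2) / 2)"
    unfolding quad_def by (intro sum_mono)
  also have "\<dots> = real (card V) * (\<Sum>i\<in>V. y i * (u i)\<^sup>2)"
    by (simp add: sum.distrib sum_divide_distrib[symmetric] sum_distrib_left[symmetric])
  finally show ?thesis .
qed

text \<open>Here \<open>a\<close> is the largest eigenvalue of \<open>w\<close> relative to \<open>diag y\<close>; rescaling rows and columns by
  an almost optimal nonnegative vector turns the all-ones vector into an almost optimal one.\<close>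

lemma dual_certificate_rescale:
  assumes "finite V" "\<And>i. (i, i) \<notin> E" "0 \<le> s" and cert: "dual_certificate V E s y w"
  shows "\<exists>a>s. \<forall>a'. 0 \<le> a' \<longrightarrow> a' < a \<longrightarrow>
    (\<exists>y' w'. dual_certificate V E a' y' w' \<and> psd_on V (\<lambda>i j. a * diag y' i j - w' i j))"
proof -
  define g where "g u = (\<Sum>i\<in>V. y i * (u i)\<^sup>2)" for u
  define X where "X = {a. 0 \<le> a \<and> (\<forall>u. quad V w u \<le> a * g u)}"
  have psd: "psd_on V (\<lambda>i j. diag y i j + w i j)"
    and w: "0 \<le> w i j" "w i i = 0" "(i, j) \<notin> E \<Longrightarrow> w i j = 0"
    and lt: "s * (\<Sum>i\<in>V. y i) < (\<Sum>i\<in>V. \<Sum>j\<in>V. w i j)" for i j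
    using assms(2) cert by (auto simp: dual_certificate_def)
  have y0: "0 \<le> y i" if "i \<in> V" for i
    using psd_on_diag_nonneg[OF assms(1) psd that] by (simp add: w)
  then have g0: "0 \<le> g u" for u
    unfolding g_def by (intro sum_nonneg) auto
  have sym: "w i j = w j i" if "i \<in> V" "j \<in> V" for i j
    using psd_on_sym[OF psd that] by (cases "i = j") auto
  have "real (card V) \<in> X"
    using dual_certificate_bound[OF assms(1,2) cert] by (simp add: X_def g_def)
  then have "X \<noteq> {}" by blast
  define a where "a = Inf X"
  have bdd: "bdd_below X" by (auto simp: X_def intro: bdd_belowI[of _ 0])
  have le: "quad V w u \<le> a * g u" for u
  proof (cases "g u = 0")
    case True
    \<comment> \<open>There is no Rayleigh quotient here; any member of \<open>X\<close> shows that
      \<open>quad V w u\<close> is at most 0.\<close>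
    obtain x where "x \<in> X" using \<open>X \<noteq> {}\<close> by blast
    then have "quad V w u \<le> x * g u" by (simp add: X_def)
    with True show ?thesis by simp
  next
    case False
    with g0[of u] have pos: "0 < g u" by simp
    have "quad V w u / g u \<le> a"
      unfolding a_def using \<open>X \<noteq> {}\<close> pos
      by (intro cInf_greatest) (auto simp: X_def divide_le_eq)
    then show ?thesis using pos by (simp add: divide_le_eq)
  qed
  have "s < a"
  proof -
    have "s * g (\<lambda>_. 1) < a * g (\<lambda>_. 1)"
      using lt le[of "\<lambda>_. 1"] by (simp add: g_def quad_def)
    then show ?thesis using g0[of "\<lambda>_. 1"] by (simp add: mult_less_cancel_right)
  qed
  moreover have "\<exists>y' w'. dual_certificate V E a' y' w' \<and> psd_on V (\<lambda>i j. a * diag y' i j - w' i j)"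
    if a': "0 \<le> a'" "a' < a" for a'
  proof -
    have "a' \<notin> X"
      using a'(2) cInf_lower[OF _ bdd] by (force simp: a_def)
    then obtain u where u: "a' * g u < quad V w u"
      using a'(1) by (auto simp: X_def not_le)
    \<comment> \<open>Both kernels are conjugated by the diagonal matrix of
      \<open>\<bar>u i\<bar>\<close>, so the all-ones vector takes over the role of
      \<open>\<bar>u\<bar>\<close>. Since \<open>w\<close> is nonnegative, absolute values can only
      raise the quadratic form.\<close>
    define y' where "y' i = y i * (u i)\<^sup>2" for i
    define w' where "w' i j = \<bar>u i\<bar> * \<bar>u j\<bar> * w i j" for i j
    have scale: "quad V w' z = quad V w (\<lambda>i. \<bar>u i\<bar> * z i)"
      "(\<Sum>i\<in>V. y' i * (z i)\<^sup>2) = g (\<lambda>i. \<bar>u i\<bar> * z i)" for z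
      by (simp_all add: quad_def w'_def g_def y'_def power_mult_distrib mult_ac)
    have "quad V w u \<le> (\<Sum>i\<in>V. \<Sum>j\<in>V. w' i j)"
      unfolding quad_def w'_def
      by (intro sum_mono mult_right_mono w) (metis abs_ge_self abs_mult)
    moreover have "g u = (\<Sum>i\<in>V. y' i)"
      by (simp add: g_def y'_def)
    ultimately have "a' * (\<Sum>i\<in>V. y' i) < (\<Sum>i\<in>V. \<Sum>j\<in>V. w' i j)"
      using u by simp
    moreover have "psd_on V (\<lambda>i j. diag y' i j + w' i j)"
      unfolding psd_on_def quad_add quad_diag[OF assms(1)] scale
    proof (intro conjI ballI allI)
      show "0 \<le> g (\<lambda>i. \<bar>u i\<bar> * z i) + quad V w (\<lambda>i. \<bar>u i\<bar> * z i)" for z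
        using psd_on_nonneg[OF psd, of "\<lambda>i. \<bar>u i\<bar> * z i"]
        by (simp only: quad_add quad_diag[OF assms(1)] g_def)
    qed (auto simp: w'_def sym mult_ac)
    moreover have "psd_on V (\<lambda>i j. a * diag y' i j - w' i j)"
    proof -
      have "quad V (\<lambda>i j. a * diag y' i j + (- 1) * w' i j) z
          = a * g (\<lambda>i. \<bar>u i\<bar> * z i) - quad V w (\<lambda>i. \<bar>u i\<bar> * z i)" for z
        by (simp only: quad_add quad_scale quad_diag[OF assms(1)] scale)
      then show ?thesis
        using le by (auto simp: psd_on_def w'_def sym mult_ac)
    qed
    ultimately show ?thesis
      using w by (intro exI[of _ y'] exI[of _ w']) (auto simp: dual_certificate_def w'_def)
  qed
  ultimately show ?thesis by blast
qed

text \<open>The lower bound for the product. Tensoring certificates of both factors gives weights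
  \<open>A i j * B l k\<close> supported on pairs of arcs, which are exactly the arcs of the
  product.\<close>

lemma gram_coloring_product:
  assumes "finite V" "sym E" "E \<subseteq> V \<times> V" "\<And>i. (i, i) \<notin> E"
    and "finite U" "sym F" "F \<subseteq> U \<times> U" "\<And>l. (l, l) \<notin> F"
    and "0 \<le> s"
    and col: "gram_coloring (V \<times> U) {((i, l), (j, k)) | i l j k. (i, j) \<in> E \<and> (l, k) \<in> F} s N"
  shows "(\<exists>M. gram_coloring V E s M) \<or> (\<exists>M. gram_coloring U F s M)"
proof (rule ccontr)
  assume "\<not> ?thesis"
  then have none: "\<not> (\<exists>M. gram_coloring V E s M)" "\<not> (\<exists>M. gram_coloring U F s M)"
    by simp_all
  obtain y0 A0 where "dual_certificate V E s y0 A0"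
    using none(1) gram_coloring_or_certificate[OF assms(1,3,2,9)] by blast
  from dual_certificate_rescale[OF assms(1,4,9) this] obtain a where a: "s < a"
    "\<forall>a'. 0 \<le> a' \<longrightarrow> a' < a \<longrightarrow>
      (\<exists>y A. dual_certificate V E a' y A \<and> psd_on V (\<lambda>i j. a * diag y i j - A i j))"
    by blast
  obtain z0 B0 where "dual_certificate U F s z0 B0"
    using none(2) gram_coloring_or_certificate[OF assms(5,7,6,9)] by blast
  from dual_certificate_rescale[OF assms(5,8,9) this] obtain b where b: "s < b"
    "\<forall>b'. 0 \<le> b' \<longrightarrow> b' < b \<longrightarrow>
      (\<exists>z B. dual_certificate U F b' z B \<and> psd_on U (\<lambda>l k. b * diag z l k - B l k))"
    by blast
  have pos: "0 < a" "0 < b" using a(1) b(1) assms(9) by linarith+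
  define c where "c = max a b"
  \<comment> \<open>Since \<open>s < min a b\<close>, this gives \<open>r < 1\<close>, so
    certificates at levels \<open>r * a\<close> and \<open>r * b\<close> exist; these levels
    multiply to \<open>c * s\<close>, the value that the final contradiction meets.\<close>
  define r where "r = sqrt (s / min a b)"
  have r: "0 \<le> r" "r < 1"
    using pos a(1) b(1) assms(9) by (simp_all add: r_def divide_less_eq)
  have "r\<^sup>2 = s / min a b"
    using pos assms(9) by (simp add: r_def)
  then have rr: "(r * a) * (r * b) = c * s"
    using pos by (simp add: c_def power2_eq_square min_def max_def field_simps split: if_splits)
  obtain y A where yA: "dual_certificate V E (r * a) y A" "psd_on V (\<lambda>i j. a * diag y i j - A i j)"
    using a(2)[rule_format, of "r * a"] r pos by (auto simp: mult_less_cancel_right1)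
  obtain z B where zB: "dual_certificate U F (r * b) z B" "psd_on U (\<lambda>l k. b * diag z l k - B l k)"
    using b(2)[rule_format, of "r * b"] r pos by (auto simp: mult_less_cancel_right1)
  have A: "0 \<le> A i j" "(i, j) \<notin> E \<Longrightarrow> A i j = 0"
    and psdA: "psd_on V (\<lambda>i j. diag y i j + A i j)"
    and sumA: "r * a * (\<Sum>i\<in>V. y i) < (\<Sum>i\<in>V. \<Sum>j\<in>V. A i j)" for i j
    using yA(1) by (auto simp: dual_certificate_def)
  have B: "0 \<le> B l k" "(l, k) \<notin> F \<Longrightarrow> B l k = 0"
    and psdB: "psd_on U (\<lambda>l k. diag z l k + B l k)"
    and sumB: "r * b * (\<Sum>l\<in>U. z l) < (\<Sum>l\<in>U. \<Sum>k\<in>U. B l k)" for l k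
    using zB(1) by (auto simp: dual_certificate_def)
  have y0: "0 \<le> y i" if "i \<in> V" for i
    using psd_on_diag_nonneg[OF assms(1) psdA that] A(2)[of i i] assms(4) by simp
  have z0: "0 \<le> z l" if "l \<in> U" for l
    using psd_on_diag_nonneg[OF assms(5) psdB that] B(2)[of l l] assms(8) by simp
  have diag_psd: "psd_on W (diag d)" if "finite W" "\<And>i. i \<in> W \<Longrightarrow> 0 \<le> d i" for W and d :: "'c \<Rightarrow> real"
    using that by (auto simp: psd_on_def quad_diag intro: sum_nonneg)
  \<comment> \<open>Raising \<open>a\<close> or \<open>b\<close> to the common constant
    \<open>c\<close> adds a nonnegative multiple of \<open>diag y\<close> or
    \<open>diag z\<close>.\<close>
  have ca: "0 \<le> c - a" and cb: "0 \<le> c - b"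
    by (simp_all add: c_def)
  have psdA': "psd_on V (\<lambda>i j. c * diag y i j - A i j)"
    using psd_on_add[OF yA(2) psd_on_scale[OF diag_psd[OF assms(1) y0] ca]]
    by (rule psd_on_cong) (auto simp: algebra_simps)
  have psdB': "psd_on U (\<lambda>l k. c * diag z l k - B l k)"
    using psd_on_add[OF zB(2) psd_on_scale[OF diag_psd[OF assms(5) z0] cb]]
    by (rule psd_on_cong) (auto simp: algebra_simps)
  \<comment> \<open>\<open>T P R\<close> pairs the tensor product of \<open>P\<close> and
    \<open>R\<close> with \<open>N\<close>.\<close>
  define T where "T P R = (\<Sum>i\<in>V. \<Sum>j\<in>V. \<Sum>l\<in>U. \<Sum>k\<in>U. P i j * R l k * N (i, l) (j, k))" for P R
  have psdN: "psd_on (V \<times> U) N" and Nd: "\<And>i l. i \<in> V \<Longrightarrow> l \<in> U \<Longrightarrow> N (i, l) (i, l) = s"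
    and Ne: "\<And>i l j k. (i, j) \<in> E \<Longrightarrow> (l, k) \<in> F \<Longrightarrow> N (i, l) (j, k) \<le> - 1"
    using col by (auto simp: gram_coloring_def)
  obtain n :: nat and x where
    x: "\<And>e f. e \<in> V \<times> U \<Longrightarrow> f \<in> V \<times> U \<Longrightarrow> N e f = (\<Sum>m<n. x m e * x m f)"
    using psd_on_imp_gram[OF _ psdN] assms(1,5) by (metis finite_cartesian_product)
  have T_nonneg: "0 \<le> T P R" if "psd_on V P" "psd_on U R" for P R
    using psd_on_tensor[OF assms(1) that, of x "{..<n}"]
    by (simp add: T_def x cong: sum.cong)
  have add: "T (\<lambda>i j. P i j + Q i j) R = T P R + T Q R" "T R' (\<lambda>i j. P' i j + Q' i j) = T R' P' + T R' Q'"
    for P Q R R' P' Q'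
    by (simp_all add: T_def distrib_left distrib_right sum.distrib)
  have diff: "T (\<lambda>i j. c * P i j - Q i j) R = c * T P R - T Q R"
    "T R' (\<lambda>i j. c * P' i j - Q' i j) = c * T R' P' - T R' Q'"
    for P Q R R' P' Q'
    by (simp_all add: T_def left_diff_distrib right_diff_distrib sum_subtractf sum_distrib_left mult_ac)
  have "0 \<le> T (diag y) (diag z) + T (diag y) B + T A (diag z) + T A B"
    using T_nonneg[OF psdA psdB] by (simp only: add)
  then have 1: "0 \<le> c * T (diag y) (diag z) + c * T (diag y) B + c * T A (diag z) + c * T A B"
    using pos by (simp add: c_def distrib_left[symmetric])
  have 2: "0 \<le> c * (c * T (diag y) (diag z)) - c * T (diag y) B - c * T A (diag z) + T A B"
    using T_nonneg[OF psdA' psdB'] by (simp only: diff) (simp add: algebra_simps)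
  \<comment> \<open>The cross terms of 1 and 2 cancel in the sum.\<close>
  have "0 \<le> (c + 1) * (c * T (diag y) (diag z) + T A B)"
    using 1 2 by (simp add: algebra_simps)
  then have 3: "0 \<le> c * T (diag y) (diag z) + T A B"
    using pos by (simp add: c_def zero_le_mult_iff max_def split: if_splits)
  have TD: "T (diag y) (diag z) = s * ((\<Sum>i\<in>V. y i) * (\<Sum>l\<in>U. z l))"
  proof -
    have "T (diag y) (diag z) = (\<Sum>i\<in>V. \<Sum>j\<in>V. if i = j then
      (\<Sum>l\<in>U. \<Sum>k\<in>U. if l = k then y i * z l * N (i, l) (j, k) else 0) else 0)"
      unfolding T_def by (intro sum.cong refl) (auto intro!: sum.cong)
    also have "\<dots> = (\<Sum>i\<in>V. \<Sum>l\<in>U. y i * z l * s)"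
      using assms(1,5) by (simp add: Nd)
    finally show ?thesis
      unfolding sum_product by (simp add: sum_distrib_left mult_ac)
  qed
  have TA: "T A B \<le> - ((\<Sum>i\<in>V. \<Sum>j\<in>V. A i j) * (\<Sum>l\<in>U. \<Sum>k\<in>U. B l k))"
  proof -
    have "A i j * B l k * N (i, l) (j, k) \<le> - (A i j * B l k)" for i j l k
    proof (cases "(i, j) \<in> E \<and> (l, k) \<in> F")
      case True
      then show ?thesis
        using mult_left_mono[OF Ne[of i j l k], of "A i j * B l k"] A(1)[of i j] B(1)[of l k] by simp
    qed (use A(2) B(2) in auto)
    then have "T A B \<le> (\<Sum>i\<in>V. \<Sum>j\<in>V. \<Sum>l\<in>U. \<Sum>k\<in>U. - (A i j * B l k))"
      unfolding T_def by (intro sum_mono)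
    also have "\<dots> = - ((\<Sum>i\<in>V. \<Sum>j\<in>V. A i j) * (\<Sum>l\<in>U. \<Sum>k\<in>U. B l k))"
      unfolding sum_distrib_right unfolding sum_distrib_left by (simp add: sum_negf)
    finally show ?thesis .
  qed
  \<comment> \<open>Fact 3 with \<open>TD\<close> and \<open>TA\<close> bounds the product of the
    total weights of \<open>A\<close> and \<open>B\<close> by \<open>c * s\<close> times the product
    of the sums of \<open>y\<close> and \<open>z\<close>; the two certificates give the strict
    opposite.\<close>
  have "(r * a * (\<Sum>i\<in>V. y i)) * (r * b * (\<Sum>l\<in>U. z l))
      < (\<Sum>i\<in>V. \<Sum>j\<in>V. A i j) * (\<Sum>l\<in>U. \<Sum>k\<in>U. B l k)"
    using r(1) pos y0 z0
    by (intro mult_strict_mono'[OF sumA sumB] mult_nonneg_nonneg sum_nonneg) auto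
  moreover have "(r * a * (\<Sum>i\<in>V. y i)) * (r * b * (\<Sum>l\<in>U. z l))
      = ((r * a) * (r * b)) * ((\<Sum>i\<in>V. y i) * (\<Sum>l\<in>U. z l))"
    by (simp only: mult_ac)
  moreover have "\<dots> = c * (s * ((\<Sum>i\<in>V. y i) * (\<Sum>l\<in>U. z l)))"
    unfolding rr by (rule mult.assoc)
  ultimately show False
    using 3 TA unfolding TD by linarith
qed

section \<open>Rank\<close>

context vec_space
begin

text \<open>Independence is restated by coordinates because coefficients are later compared between
  spaces of different dimension.\<close>

lemma lin_indpt_by_index:
  assumes "finite U" "U \<subseteq> carrier_vec n"
    and indpt: "\<And>a u. (\<And>m. m < n \<Longrightarrow> (\<Sum>x\<in>U. a x * x $ m) = 0) \<Longrightarrow> u \<in> U \<Longrightarrow> a u = 0"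
  shows "lin_indpt U"
proof (rule finite_lin_indpt2[OF assms(1,2)], rule ballI)
  fix a u assume a: "lincomb a U = 0\<^sub>v n" and "u \<in> U"
  show "a u = 0"
  proof (rule indpt[OF _ \<open>u \<in> U\<close>])
    show "(\<Sum>x\<in>U. a x * x $ m) = 0" if "m < n" for m
      using lincomb_index[OF that assms(2), of a] a that by simp
  qed
qed

lemma lin_indpt_index:
  assumes "lin_indpt U" "finite U" "U \<subseteq> carrier_vec n"
    and "\<And>m. m < n \<Longrightarrow> (\<Sum>x\<in>U. a x * x $ m) = 0" "u \<in> U"
  shows "a u = 0"
proof -
  have "lincomb a U = 0\<^sub>v n"
    using assms(2-4) by (intro eq_vecI) (simp_all add: lincomb_index lincomb_dim)
  then show ?thesis
    using not_lindepD[OF assms(1,2) subset_refl, of a] assms(5) by auto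
qed

lemma maximal_lin_indpt_span_index:
  assumes "maximal U (\<lambda>T. T \<subseteq> S \<and> lin_indpt T)" "finite S" "S \<subseteq> carrier_vec n" "v \<in> S"
  shows "\<exists>a. \<forall>m<n. v $ m = (\<Sum>x\<in>U. a x * x $ m)"
proof -
  have U: "U \<subseteq> S" "lin_indpt U" and max: "\<And>B. U \<subseteq> B \<Longrightarrow> B \<subseteq> S \<Longrightarrow> lin_indpt B \<Longrightarrow> B = U"
    using assms(1) by (auto simp: maximal_def)
  have fin: "finite U" and car: "U \<subseteq> carrier_vec n"
    using U(1) assms(2,3) by (auto intro: finite_subset)
  have "v \<in> span U"
  proof (cases "v \<in> U")
    case True
    then show ?thesis using span_mem[of U v] car by simp
  next
    case False
    then have "lin_dep (U \<union> {v})"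
      using max[of "U \<union> {v}"] U assms(4) by blast
    then show ?thesis
      using lin_dep_iff_in_span[of U v] False car U(2) assms(3,4) by auto
  qed
  then obtain a where "lincomb a U = v"
    using finite_in_span[OF fin, of v] car by auto
  then show ?thesis
    using lincomb_index[OF _ car, of _ a] by auto
qed

lemma dim_span_basis:
  assumes "finite S" "S \<subseteq> carrier_vec n"
  obtains U where "U \<subseteq> S" "lin_indpt U" "card U = vectorspace.dim class_ring (span_vs S)"
proof -
  have "lin_indpt {}" by (rule lin_indpt_by_index) auto
  then obtain U where U: "maximal U (\<lambda>T. T \<subseteq> S \<and> lin_indpt T)"
    using maximal_exists_superset[OF assms(1), of "\<lambda>T. T \<subseteq> S \<and> lin_indpt T" "{}"] by auto
  with dim_span[of S U] assms that show ?thesis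
    by (auto simp: maximal_def)
qed

text \<open>Extend \<open>W\<close> to a maximal independent subset of \<open>S\<close>; its
  cardinality is the dimension, so the extension is \<open>W\<close> itself.\<close>

lemma lin_indpt_card_ge_dim_spans:
  assumes "finite S" "S \<subseteq> carrier_vec n" "W \<subseteq> S" "lin_indpt W"
    and "vectorspace.dim class_ring (span_vs S) \<le> card W" "v \<in> S"
  shows "\<exists>a. \<forall>m<n. v $ m = (\<Sum>x\<in>W. a x * x $ m)"
proof -
  obtain U where U: "maximal U (\<lambda>T. T \<subseteq> S \<and> lin_indpt T)" "W \<subseteq> U" "finite U"
    using maximal_exists_superset[OF assms(1), of "\<lambda>T. T \<subseteq> S \<and> lin_indpt T" W] assms(3,4) by auto
  have "card U \<le> card W"
    using dim_span[of S U] U(1) assms(1,2,5) by simp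
  then have "W = U"
    using U(2,3) by (simp add: card_seteq)
  with maximal_lin_indpt_span_index[OF U(1) assms(1,2,6)] show ?thesis by simp
qed

end

section \<open>Ranks of colorings\<close>

lemma coloring_rank_le_card:
  assumes "finite (pverts G)" "\<And>i. i \<in> pverts G \<Longrightarrow> p i \<in> carrier_vec d"
  shows "coloring_rank G d p \<le> card (pverts G)"
proof -
  interpret vec_space "TYPE(real)" d .
  have "finite (p ` pverts G)" "p ` pverts G \<subseteq> carrier_vec d"
    using assms by auto
  then obtain U where "U \<subseteq> p ` pverts G" "card U = coloring_rank G d p"
    unfolding coloring_rank_def by (rule dim_span_basis)
  then show ?thesis
    using assms(1) by (metis card_image_le card_mono finite_imageI order_trans)
qed

text \<open>The projection of \<open>span (c ` V)\<close> onto the first \<open>d\<close> coordinates has image \<open>span (p ` V)\<close>, so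
  it is injective once the ranks agree.\<close>

lemma eq_of_coloring_rank_le_projection:
  assumes "finite (pverts X)" "d \<le> e" "r \<noteq> 0"
    and p: "\<And>w. w \<in> pverts X \<Longrightarrow> p w \<in> carrier_vec d"
    and c: "\<And>w. w \<in> pverts X \<Longrightarrow> c w \<in> carrier_vec e"
    and proj: "\<And>w m. w \<in> pverts X \<Longrightarrow> m < d \<Longrightarrow> c w $ m = r * p w $ m"
    and rank: "coloring_rank X e c \<le> coloring_rank X d p"
    and w: "w \<in> pverts X" "w' \<in> pverts X" "p w = p w'"
  shows "c w = c w'"
proof -
  interpret P: vec_space "TYPE(real)" d .
  interpret C: vec_space "TYPE(real)" e .
  let ?V = "pverts X"
  have pcar: "p ` ?V \<subseteq> carrier_vec d" and ccar: "c ` ?V \<subseteq> carrier_vec e"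
    using p c by auto
  have fin: "finite (p ` ?V)" "finite (c ` ?V)"
    using assms(1) by auto
  obtain U where U: "U \<subseteq> p ` ?V" "P.lin_indpt U" "card U = coloring_rank X d p"
    unfolding coloring_rank_def by (rule P.dim_span_basis[OF fin(1) pcar])
  have finU: "finite U" and Ucar: "U \<subseteq> carrier_vec d"
    using U(1) fin(1) pcar by (auto intro: finite_subset)
  have "\<forall>u\<in>U. \<exists>v\<in>?V. p v = u" using U(1) by auto
  then obtain g where g: "\<And>u. u \<in> U \<Longrightarrow> g u \<in> ?V" "\<And>u. u \<in> U \<Longrightarrow> p (g u) = u"
    by metis
  \<comment> \<open>\<open>f\<close> lifts a basis of the span of \<open>p\<close> to vectors of
    \<open>c\<close>, through one chosen vertex for each basis vector.\<close>
  define f where "f u = c (g u)" for u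
  have f_index: "f u $ m = r * u $ m" if "u \<in> U" "m < d" for u m
    using proj[OF g(1) that(2)] g(2) that(1) by (simp add: f_def)
  have inj: "inj_on f U"
  proof (rule inj_onI)
    fix u v assume uv: "u \<in> U" "v \<in> U" "f u = f v"
    show "u = v"
    proof (rule eq_vecI)
      have car: "u \<in> carrier_vec d" "v \<in> carrier_vec d" using uv Ucar by auto
      then show "dim_vec u = dim_vec v" by simp
      show "u $ m = v $ m" if "m < dim_vec v" for m
      proof -
        have "m < d" using that car(2) by simp
        with f_index uv have "r * u $ m = r * v $ m" by metis
        with \<open>r \<noteq> 0\<close> show ?thesis by simp
      qed
    qed
  qed
  \<comment> \<open>The first \<open>d\<close> coordinates alone determine coefficients on the lift.
    This gives its independence and, at the end, equal coefficients for \<open>c w\<close> and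
    \<open>c w'\<close>.\<close>
  have zero: "b u = 0"
    if "\<And>m. m < d \<Longrightarrow> (\<Sum>v\<in>U. b v * f v $ m) = 0" "u \<in> U" for b u
  proof (rule P.lin_indpt_index[OF U(2) finU Ucar _ that(2)])
    fix m assume "m < d"
    have "r * (\<Sum>v\<in>U. b v * v $ m) = (\<Sum>v\<in>U. b v * f v $ m)"
      unfolding sum_distrib_left by (intro sum.cong refl) (simp add: f_index \<open>m < d\<close>)
    with that(1)[OF \<open>m < d\<close>] \<open>r \<noteq> 0\<close> show "(\<Sum>v\<in>U. b v * v $ m) = 0" by simp
  qed
  have reindex: "(\<Sum>x\<in>f ` U. a x * x $ m) = (\<Sum>v\<in>U. a (f v) * f v $ m)" for a and m :: nat
    using sum.reindex[OF inj] by simp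
  have sub: "f ` U \<subseteq> c ` ?V"
    using g(1) by (auto simp: f_def)
  have indpt: "C.lin_indpt (f ` U)"
  proof (rule C.lin_indpt_by_index)
    fix a x assume a: "\<And>m. m < e \<Longrightarrow> (\<Sum>x\<in>f ` U. a x * x $ m) = 0" and "x \<in> f ` U"
    have "(\<Sum>v\<in>U. a (f v) * f v $ m) = 0" if "m < d" for m
      using a[of m] that \<open>d \<le> e\<close> by (simp add: reindex)
    then show "a x = 0"
      using zero[of "\<lambda>v. a (f v)"] \<open>x \<in> f ` U\<close> by blast
  qed (use finU sub ccar in auto)
  \<comment> \<open>By the rank hypothesis the lifted set is large enough to span all vectors of
    \<open>c\<close>.\<close>
  have le: "vectorspace.dim class_ring (C.span_vs (c ` ?V)) \<le> card (f ` U)"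
    using rank U(3) card_image[OF inj] by (simp add: coloring_rank_def)
  note spans = C.lin_indpt_card_ge_dim_spans[OF fin(2) ccar sub indpt le]
  obtain a where a: "\<And>m. m < e \<Longrightarrow> c w $ m = (\<Sum>v\<in>U. a (f v) * f v $ m)"
    using spans[of "c w"] w(1) unfolding reindex by auto
  obtain b where b: "\<And>m. m < e \<Longrightarrow> c w' $ m = (\<Sum>v\<in>U. b (f v) * f v $ m)"
    using spans[of "c w'"] w(2) unfolding reindex by auto
  have eq: "a (f u) = b (f u)" if "u \<in> U" for u
  proof -
    have "a (f u) - b (f u) = 0"
    proof (rule zero[of "\<lambda>u. a (f u) - b (f u)", OF _ that])
      fix m assume "m < d"
      then have "c w $ m = c w' $ m" using proj w by simp
      then show "(\<Sum>v\<in>U. (a (f v) - b (f v)) * f v $ m) = 0"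
        using a[of m] b[of m] \<open>m < d\<close> \<open>d \<le> e\<close> by (simp add: left_diff_distrib sum_subtractf)
    qed
    then show ?thesis by simp
  qed
  show ?thesis
  proof (rule eq_vecI)
    show "dim_vec (c w) = dim_vec (c w')" using c[OF w(1)] c[OF w(2)] by simp
    show "c w $ m = c w' $ m" if "m < dim_vec (c w')" for m
      using that c[OF w(2)] by (simp add: a b eq)
  qed
qed

lemma scalar_prod_eq_imp_eq:
  fixes x y :: "real vec"
  assumes "x \<in> carrier_vec d" "y \<in> carrier_vec d" "x \<bullet> x = x \<bullet> y" "y \<bullet> y = x \<bullet> y"
  shows "x = y"
proof (rule eq_vecI)
  have "(\<Sum>m<d. (x $ m - y $ m)\<^sup>2) = x \<bullet> x - 2 * (x \<bullet> y) + y \<bullet> y"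
  proof -
    have "(x $ m - y $ m)\<^sup>2 = x $ m * x $ m - 2 * (x $ m * y $ m) + y $ m * y $ m" for m
      by (simp add: power2_eq_square algebra_simps)
    then show ?thesis
      using assms(1,2)
      by (simp add: scalar_prod_def lessThan_atLeast0 sum.distrib sum_subtractf sum_distrib_left)
  qed
  then have "(\<Sum>m<d. (x $ m - y $ m)\<^sup>2) = 0"
    using assms(3,4) by simp
  then have "\<forall>m\<in>{..<d}. (x $ m - y $ m)\<^sup>2 = 0"
    by (subst (asm) sum_nonneg_eq_0_iff) auto
  then show "x $ m = y $ m" if "m < dim_vec y" for m
    using that assms(2) by simp
qed (use assms in simp)

section \<open>Vector colorings of graphs\<close>

lemma pair_graph_arcs:
  assumes "pair_graph G"
  shows "finite (pverts G)" "parcs G \<subseteq> pverts G \<times> pverts G" "sym (parcs G)" "(i, i) \<notin> parcs G"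
proof -
  interpret pair_graph G by fact
  show "finite (pverts G)" by simp
  show "parcs G \<subseteq> pverts G \<times> pverts G"
    by (auto dest: in_arcsD1 in_arcsD2)
  show "sym (parcs G)"
    using sym_arcs by (simp add: symmetric_def)
  show "(i, i) \<notin> parcs G"
    using no_loops' by blast
qed

lemma vector_coloring_scalar_prod_sum:
  assumes "vector_coloring G t d p" "i \<in> pverts G" "j \<in> pverts G"
  shows "p i \<bullet> p j = (\<Sum>m<d. p i $ m * p j $ m)"
proof -
  have "dim_vec (p j) = d"
    using assms by (simp add: vector_coloring_def carrier_vecD)
  then show ?thesis by (simp add: scalar_prod_def lessThan_atLeast0)
qed

text \<open>The bound \<open>1 \<le> t\<close> stands separately because a Gram kernel on no
  vertices puts no constraint on \<open>t\<close>.\<close>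

lemma ex_vector_coloring_iff_gram:
  assumes "pair_graph G"
  shows "(\<exists>d p. vector_coloring G t d p) \<longleftrightarrow>
    1 \<le> t \<and> (\<exists>M. gram_coloring (pverts G) (parcs G) (t - 1) M)"
proof
  assume "\<exists>d p. vector_coloring G t d p"
  then obtain d p where p: "vector_coloring G t d p" by blast
  have "psd_on (pverts G) (\<lambda>i j. p i \<bullet> p j)"
    by (rule psd_on_cong[OF psd_on_gram[where I = "{..<d}" and x = "\<lambda>m i. p i $ m"]])
      (simp add: vector_coloring_scalar_prod_sum[OF p])
  then have "gram_coloring (pverts G) (parcs G) (t - 1) (\<lambda>i j. p i \<bullet> p j)"
    using p by (simp add: gram_coloring_def vector_coloring_def)
  then show "1 \<le> t \<and> (\<exists>M. gram_coloring (pverts G) (parcs G) (t - 1) M)"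
    using p by (auto simp: vector_coloring_def)
next
  note G = pair_graph_arcs[OF assms]
  assume "1 \<le> t \<and> (\<exists>M. gram_coloring (pverts G) (parcs G) (t - 1) M)"
  then obtain M where "1 \<le> t" and M: "gram_coloring (pverts G) (parcs G) (t - 1) M" by blast
  obtain n :: nat and x where
    x: "\<And>i j. i \<in> pverts G \<Longrightarrow> j \<in> pverts G \<Longrightarrow> M i j = (\<Sum>m<n. x m i * x m j)"
    using psd_on_imp_gram[OF G(1)] M unfolding gram_coloring_def by metis
  define p where "p i = vec n (\<lambda>m. x m i)" for i
  have "p i \<bullet> p j = M i j" if "i \<in> pverts G" "j \<in> pverts G" for i j
    using that by (simp add: p_def scalar_prod_def x lessThan_atLeast0)
  then have "vector_coloring G t n p"
    using M \<open>1 \<le> t\<close> G(2) by (fastforce simp: vector_coloring_def gram_coloring_def p_def)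
  then show "\<exists>d p. vector_coloring G t d p" by blast
qed

text \<open>Weak duality. The level \<open>s'\<close> of the certificate may differ from
  \<open>s\<close>, so one certificate bounds the level of every coloring.\<close>

lemma gram_coloring_certificate_le:
  assumes "finite V" "E \<subseteq> V \<times> V" "\<And>i. (i, i) \<notin> E"
    and M: "gram_coloring V E s M" and cert: "dual_certificate V E s' y w"
  shows "(\<Sum>i\<in>V. \<Sum>j\<in>V. w i j) \<le> s * (\<Sum>i\<in>V. y i)"
proof -
  have psd: "psd_on V (\<lambda>i j. diag y i j + w i j)"
    and w: "0 \<le> w i j" "(i, j) \<notin> E \<Longrightarrow> w i j = 0" for i j
    using cert by (auto simp: dual_certificate_def)
  have psdM: "psd_on V M" and Md: "\<And>i. i \<in> V \<Longrightarrow> M i i = s" and Me: "\<And>i j. (i, j) \<in> E \<Longrightarrow> M i j \<le> - 1"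
    using M by (auto simp: gram_coloring_def)
  obtain n :: nat and x where
    x: "\<And>i j. i \<in> V \<Longrightarrow> j \<in> V \<Longrightarrow> M i j = (\<Sum>m<n. x m i * x m j)"
    using psd_on_imp_gram[OF assms(1) psdM] by metis
  \<comment> \<open>A one-point second factor with kernel 1 reduces the tensor pairing to the trace
    pairing of two kernels.\<close>
  have "0 \<le> (\<Sum>i\<in>V. \<Sum>j\<in>V. (diag y i j + w i j) * M i j)"
    using psd_on_tensor[OF assms(1) psd psd_on_rank_one[of "{()}" "\<lambda>_. 1"], where x = "\<lambda>m e. x m (fst e)"
        and I = "{..<n}"]
    by (simp add: x cong: sum.cong)
  also have "\<dots> = (\<Sum>i\<in>V. \<Sum>j\<in>V. diag (\<lambda>i. y i * M i i) i j) + (\<Sum>i\<in>V. \<Sum>j\<in>V. w i j * M i j)"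
    unfolding sum.distrib[symmetric] by (intro sum.cong refl) (simp add: distrib_right)
  also have "(\<Sum>i\<in>V. \<Sum>j\<in>V. diag (\<lambda>i. y i * M i i) i j) = s * (\<Sum>i\<in>V. y i)"
    using assms(1) by (simp add: Md sum_distrib_left mult_ac)
  also have "(\<Sum>i\<in>V. \<Sum>j\<in>V. w i j * M i j) \<le> (\<Sum>i\<in>V. \<Sum>j\<in>V. - w i j)"
  proof (intro sum_mono)
    show "w i j * M i j \<le> - w i j" for i j
    proof (cases "(i, j) \<in> E")
      case True
      then show ?thesis using mult_left_mono[OF Me w(1)[of i j]] by simp
    qed (simp add: w)
  qed
  finally show ?thesis by (simp add: sum_negf)
qed

section \<open>Existence of colorings and attainment of the optimum\<close>

lemma dual_certificate_weight_nonneg: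
  assumes "finite V" "\<And>i. (i, i) \<notin> E" "dual_certificate V E s y w" "i \<in> V"
  shows "0 \<le> y i"
  using psd_on_diag_nonneg[of V "\<lambda>i j. diag y i j + w i j" i] assms
  by (simp add: dual_certificate_def)

text \<open>By \<open>dual_certificate_bound\<close> at the all-ones vector there is no certificate
  at level \<open>card (pverts G)\<close>, hence a coloring exists there.\<close>

lemma ex_vector_coloring:
  assumes "pair_graph G"
  shows "\<exists>t d p. vector_coloring G t d p"
proof -
  note G = pair_graph_arcs[OF assms]
  let ?n = "real (card (pverts G))"
  have "\<not> dual_certificate (pverts G) (parcs G) ?n y w" for y w
    using dual_certificate_bound[OF G(1,4), of ?n y w "\<lambda>_. 1"]
    by (auto simp: dual_certificate_def quad_def)
  then have "\<exists>M. gram_coloring (pverts G) (parcs G) ?n M"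
    using gram_coloring_or_certificate[OF G(1-3), of ?n] by auto
  then show ?thesis
    using ex_vector_coloring_iff_gram[OF assms, of "?n + 1"] by auto
qed

text \<open>A \<open>LEAST\<close> over the reals is meaningful only if the infimum is attained. A
  certificate at an infeasible infimum would, by weak duality, keep all feasible levels a positive
  distance above it.\<close>

lemma vector_chromatic_number_props:
  assumes "pair_graph G"
  shows vector_chromatic_number_attained:
      "\<exists>d p. vector_coloring G (vector_chromatic_number G) d p" (is ?A)
    and vector_chromatic_number_le:
      "\<And>t d p. vector_coloring G t d p \<Longrightarrow> vector_chromatic_number G \<le> t"
proof -
  note G = pair_graph_arcs[OF assms]
  define T where "T = {t. \<exists>d p. vector_coloring G t d p}"
  have T: "t \<in> T \<longleftrightarrow> 1 \<le> t \<and> (\<exists>M. gram_coloring (pverts G) (parcs G) (t - 1) M)" for t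
    using ex_vector_coloring_iff_gram[OF assms] by (simp add: T_def)
  have "T \<noteq> {}"
    using ex_vector_coloring[OF assms] by (auto simp: T_def)
  have bdd: "bdd_below T"
    using T by (auto intro: bdd_belowI[of _ 1])
  have ge: "1 \<le> Inf T"
    using \<open>T \<noteq> {}\<close> T by (intro cInf_greatest) auto
  have "Inf T \<in> T"
  proof (rule ccontr)
    assume "Inf T \<notin> T"
    then obtain y w where cert: "dual_certificate (pverts G) (parcs G) (Inf T - 1) y w"
      using gram_coloring_or_certificate[OF G(1-3), of "Inf T - 1"] T ge by auto
    let ?y = "\<Sum>i\<in>pverts G. y i" and ?w = "\<Sum>i\<in>pverts G. \<Sum>j\<in>pverts G. w i j"
    have lt: "(Inf T - 1) * ?y < ?w"
      using cert by (simp add: dual_certificate_def)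
    have le: "?w \<le> (t - 1) * ?y" if "t \<in> T" for t
      using gram_coloring_certificate_le[OF G(1,2,4) _ cert] T that by blast
    have "0 \<le> ?y"
      by (intro sum_nonneg dual_certificate_weight_nonneg[OF G(1,4) cert])
    moreover have "?y \<noteq> 0"
    proof
      assume "?y = 0"
      with lt le \<open>T \<noteq> {}\<close> show False by force
    qed
    ultimately have pos: "0 < ?y" by simp
    have "?w / ?y + 1 \<le> t" if "t \<in> T" for t
      using le[OF that] pos by (simp add: field_simps)
    then have "?w / ?y + 1 \<le> Inf T"
      using \<open>T \<noteq> {}\<close> by (intro cInf_greatest)
    with lt pos show False by (simp add: field_simps)
  qed
  have low: "Inf T \<le> t" if "t \<in> T" for t
    using cInf_lower[OF that bdd] .
  have "vector_chromatic_number G = Inf T"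
    unfolding vector_chromatic_number_def
    using \<open>Inf T \<in> T\<close> low by (intro Least_equality) (auto simp: T_def)
  then show ?A "\<And>t d p. vector_coloring G t d p \<Longrightarrow> vector_chromatic_number G \<le> t"
    using \<open>Inf T \<in> T\<close> low by (auto simp: T_def)
qed

lemma vector_chromatic_number_ge_1:
  assumes "pair_graph G"
  shows "1 \<le> vector_chromatic_number G"
  using vector_chromatic_number_attained[OF assms] by (auto simp: vector_coloring_def)

section \<open>Colorings of the categorical product\<close>

lemma pverts_categorical_product [simp]:
  "pverts (categorical_product G H) = pverts G \<times> pverts H"
  by (simp add: categorical_product_def)

lemma parcs_categorical_product:
  "parcs (categorical_product G H)
    = {((i, l), (j, k)) | i l j k. (i, j) \<in> parcs G \<and> (l, k) \<in> parcs H}"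
  by (simp add: categorical_product_def)

lemma vector_coloring_product_left:
  assumes "vector_coloring G t d p"
  shows "vector_coloring (categorical_product G H) t d (\<lambda>(i, l). p i)"
  using assms by (fastforce simp: vector_coloring_def parcs_categorical_product)

lemma vector_chromatic_number_product:
  assumes G: "pair_graph G" and H: "pair_graph H"
    and less: "vector_chromatic_number G < vector_chromatic_number H"
  shows "vector_chromatic_number (categorical_product G H) = vector_chromatic_number G"
proof (rule antisym)
  let ?X = "categorical_product G H"
  have X: "pair_graph ?X"
    by (rule pair_graph_categorical_product[OF G H])
  show le: "vector_chromatic_number ?X \<le> vector_chromatic_number G"
    using vector_chromatic_number_attained[OF G] vector_coloring_product_left
      vector_chromatic_number_le[OF X] by blast
  let ?t = "vector_chromatic_number ?X"
  have "1 \<le> ?t" by (rule vector_chromatic_number_ge_1[OF X])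
  obtain N where "gram_coloring (pverts ?X) (parcs ?X) (?t - 1) N"
    using vector_chromatic_number_attained[OF X] ex_vector_coloring_iff_gram[OF X] by blast
  then have "(\<exists>M. gram_coloring (pverts G) (parcs G) (?t - 1) M) \<or>
      (\<exists>M. gram_coloring (pverts H) (parcs H) (?t - 1) M)"
    using \<open>1 \<le> ?t\<close>
    by (intro gram_coloring_product pair_graph_arcs[OF G] pair_graph_arcs[OF H])
      (simp_all add: parcs_categorical_product)
  \<comment> \<open>The alternative for \<open>H\<close> is impossible: it would put the number of
    \<open>H\<close> at most \<open>?t\<close>, hence at most that of \<open>G\<close>.\<close>
  then show "vector_chromatic_number G \<le> ?t"
    using ex_vector_coloring_iff_gram[OF G, of ?t] ex_vector_coloring_iff_gram[OF H, of ?t] \<open>1 \<le> ?t\<close>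
      vector_chromatic_number_le[OF G, of ?t] vector_chromatic_number_le[OF H, of ?t] less le
    by fastforce
qed

text \<open>Justifies the \<open>Max\<close> in \<open>max_coloring_rank\<close>: dimensions are
  unbounded, ranks are not.\<close>

lemma finite_coloring_ranks:
  assumes "pair_graph G"
  shows "finite {coloring_rank G d p | d p. optimal_vector_coloring G d p}"
proof (rule finite_subset)
  show "{coloring_rank G d p | d p. optimal_vector_coloring G d p} \<subseteq> {..card (pverts G)}"
    using coloring_rank_le_card[OF pair_graph_arcs(1)[OF assms]]
    by (auto simp: optimal_vector_coloring_def vector_coloring_def)
qed simp

lemma coloring_rank_le_max:
  assumes "pair_graph G" "optimal_vector_coloring G d p"
  shows "coloring_rank G d p \<le> max_coloring_rank G"
  unfolding max_coloring_rank_def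
  using assms(2) by (intro Max_ge finite_coloring_ranks[OF assms(1)]) auto

lemma max_coloring_rank_attained:
  assumes "pair_graph G"
  obtains d p where "optimal_vector_coloring G d p" "coloring_rank G d p = max_coloring_rank G"
proof -
  have "{coloring_rank G d p | d p. optimal_vector_coloring G d p} \<noteq> {}"
    using vector_chromatic_number_attained[OF assms] by (auto simp: optimal_vector_coloring_def)
  from Max_in[OF finite_coloring_ranks[OF assms] this] that show ?thesis
    unfolding max_coloring_rank_def by auto
qed

lemma coloring_rank_product_left:
  assumes "pverts H \<noteq> {}" "\<And>i l. i \<in> pverts G \<Longrightarrow> l \<in> pverts H \<Longrightarrow> q (i, l) = p i"
  shows "coloring_rank (categorical_product G H) d q = coloring_rank G d p"
proof -
  have "q ` (pverts G \<times> pverts H) = p ` pverts G"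
    using assms by force
  then show ?thesis by (simp add: coloring_rank_def)
qed

text \<open>Without arcs, zero vectors in dimension 0 form a vector 1-coloring.\<close>

lemma ex_arc_of_vector_chromatic_number_gt_1:
  assumes "pair_graph H" "1 < vector_chromatic_number H"
  shows "parcs H \<noteq> {}"
proof
  assume "parcs H = {}"
  then have "vector_coloring H 1 0 (\<lambda>_. 0\<^sub>v 0)"
    by (simp add: vector_coloring_def)
  with vector_chromatic_number_le[OF assms(1)] assms(2) show False by fastforce
qed

text \<open>An arc of \<open>G\<close> lifts to a product arc through the single arc
  \<open>(l, k)\<close> of \<open>H\<close>; constancy on fibres then moves \<open>k\<close> back to
  \<open>l\<close>.\<close>

lemma optimal_vector_coloring_fibre:
  assumes "pair_graph H" and arc: "(l, k) \<in> parcs H"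
    and chi: "vector_chromatic_number (categorical_product G H) = vector_chromatic_number G"
    and q: "optimal_vector_coloring (categorical_product G H) d q"
    and const: "\<And>i l k. i \<in> pverts G \<Longrightarrow> l \<in> pverts H \<Longrightarrow> k \<in> pverts H \<Longrightarrow> q (i, l) = q (i, k)"
    and arcs: "parcs G \<subseteq> pverts G \<times> pverts G"
  shows "optimal_vector_coloring G d (\<lambda>i. q (i, l))"
proof -
  have lk: "l \<in> pverts H" "k \<in> pverts H"
    using pair_graph_arcs(2)[OF assms(1)] arc by auto
  have "q (i, l) \<bullet> q (j, l) \<le> - 1" if "(i, j) \<in> parcs G" for i j
  proof -
    have "((i, l), (j, k)) \<in> parcs (categorical_product G H)"
      using that arc by (simp add: parcs_categorical_product)
    then have "q (i, l) \<bullet> q (j, k) \<le> - 1"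
      using q by (auto simp: optimal_vector_coloring_def vector_coloring_def)
    moreover have "q (j, k) = q (j, l)"
      using that arcs lk by (intro const) auto
    ultimately show ?thesis by simp
  qed
  then show ?thesis
    using q lk by (auto simp: optimal_vector_coloring_def vector_coloring_def chi)
qed

theorem mainTheorem2:
  fixes G :: "'a pair_pre_digraph" and H :: "'b pair_pre_digraph"
  assumes "pair_graph G" and "pair_graph H"
    and "vector_chromatic_number G < vector_chromatic_number H"
  shows "max_coloring_rank (categorical_product G H) \<ge> max_coloring_rank G \<and>
         (max_coloring_rank (categorical_product G H) = max_coloring_rank G \<longleftrightarrow>
           (\<forall>d q. optimal_vector_coloring (categorical_product G H) d q \<longrightarrow>
              induced_by_left G H q))"
proof -
  let ?X = "categorical_product G H"
  let ?t = "vector_chromatic_number G"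
  have X: "pair_graph ?X"
    by (rule pair_graph_categorical_product[OF assms(1,2)])
  note chi = vector_chromatic_number_product[OF assms]
  have "1 < vector_chromatic_number H"
    using vector_chromatic_number_ge_1[OF assms(1)] assms(3) by simp
  then obtain l0 k0 where arc: "(l0, k0) \<in> parcs H"
    using ex_arc_of_vector_chromatic_number_gt_1[OF assms(2)] by auto
  then have l0: "l0 \<in> pverts H"
    using pair_graph_arcs(2)[OF assms(2)] by auto
  then have ne: "pverts H \<noteq> {}" by auto
  have opt_left: "optimal_vector_coloring ?X d (\<lambda>(i, l). p i)" if "optimal_vector_coloring G d p" for d p
    using vector_coloring_product_left[of G ?t d p H] that
    by (simp add: optimal_vector_coloring_def chi)
  note fibre = optimal_vector_coloring_fibre[OF assms(2) arc chi _ _ pair_graph_arcs(2)[OF assms(1)]]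
  obtain d1 p where p: "optimal_vector_coloring G d1 p" "coloring_rank G d1 p = max_coloring_rank G"
    by (rule max_coloring_rank_attained[OF assms(1)])
  have rank_left: "coloring_rank ?X d1 (\<lambda>(i, l). p i) = max_coloring_rank G"
    using coloring_rank_product_left[OF ne, of G "\<lambda>(i, l). p i" p d1] p(2) by simp
  have ge: "max_coloring_rank G \<le> max_coloring_rank ?X"
    using coloring_rank_le_max[OF X opt_left[OF p(1)]] rank_left by simp
  have "induced_by_left G H q"
    if eq: "max_coloring_rank ?X = max_coloring_rank G" and q: "optimal_vector_coloring ?X d2 q" for d2 q
  proof -
    \<comment> \<open>With \<open>r * r = 1 / 2\<close> the Gram kernel of \<open>c\<close> is the
      mean of those of \<open>p\<close> and \<open>q\<close>, so all constraints persist.\<close>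
    define r :: real where "r = sqrt (1 / 2)"
    have r: "r \<noteq> 0" "r * r = 1 / 2" by (simp_all add: r_def)
    define c where "c = (\<lambda>(i, l). r \<cdot>\<^sub>v p i @\<^sub>v r \<cdot>\<^sub>v q (i, l))"
    have pcar: "p i \<in> carrier_vec d1" if "i \<in> pverts G" for i
      using p(1) that by (simp add: optimal_vector_coloring_def vector_coloring_def)
    have qcar: "q (i, l) \<in> carrier_vec d2" if "i \<in> pverts G" "l \<in> pverts H" for i l
      using q that by (simp add: optimal_vector_coloring_def vector_coloring_def)
    have ccar: "c w \<in> carrier_vec (d1 + d2)" if "w \<in> pverts ?X" for w
      using that pcar qcar by (auto simp: c_def intro!: append_carrier_vec)
    have prod: "c (i, l) \<bullet> c (j, k) = (p i \<bullet> p j + q (i, l) \<bullet> q (j, k)) / 2"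
      if "i \<in> pverts G" "j \<in> pverts G" "l \<in> pverts H" "k \<in> pverts H" for i j l k
    proof -
      note car = pcar[OF that(1)] pcar[OF that(2)] qcar[OF that(1,3)] qcar[OF that(2,4)]
      have "c (i, l) \<bullet> c (j, k)
          = (r \<cdot>\<^sub>v p i) \<bullet> (r \<cdot>\<^sub>v p j) + (r \<cdot>\<^sub>v q (i, l)) \<bullet> (r \<cdot>\<^sub>v q (j, k))"
        unfolding c_def prod.case using car by (intro scalar_prod_append) auto
      also have "\<dots> = (r * r) * (p i \<bullet> p j) + (r * r) * (q (i, l) \<bullet> q (j, k))"
        using car by simp
      finally show ?thesis by (simp add: r(2))
    qed
    have c: "optimal_vector_coloring ?X (d1 + d2) c"
      unfolding optimal_vector_coloring_def vector_coloring_def chi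
    proof (intro conjI ballI)
      show "1 \<le> ?t" by (rule vector_chromatic_number_ge_1[OF assms(1)])
      show "c w \<in> carrier_vec (d1 + d2)" if "w \<in> pverts ?X" for w
        using ccar[OF that] .
      show "c w \<bullet> c w = ?t - 1" if "w \<in> pverts ?X" for w
        using that p(1) q
        by (auto simp: prod optimal_vector_coloring_def vector_coloring_def chi)
      show "case e of (v, w) \<Rightarrow> c v \<bullet> c w \<le> - 1" if e: "e \<in> parcs ?X" for e
      proof -
        obtain i l j k where ijkl: "e = ((i, l), (j, k))" "(i, j) \<in> parcs G" "(l, k) \<in> parcs H"
          using e by (auto simp: parcs_categorical_product)
        have mem: "i \<in> pverts G" "j \<in> pverts G" "l \<in> pverts H" "k \<in> pverts H"
          using ijkl pair_graph_arcs(2)[OF assms(1)] pair_graph_arcs(2)[OF assms(2)] by auto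
        have "p i \<bullet> p j \<le> - 1"
          using p(1) ijkl(2) by (auto simp: optimal_vector_coloring_def vector_coloring_def)
        moreover have "q (i, l) \<bullet> q (j, k) \<le> - 1"
          using q e ijkl(1) by (auto simp: optimal_vector_coloring_def vector_coloring_def)
        ultimately show ?thesis
          using ijkl(1) prod[OF mem] by simp
      qed
    qed
    have const: "q (i, l) = q (i, k)" if "i \<in> pverts G" "l \<in> pverts H" "k \<in> pverts H" for i l k
    proof -
      have "c (i, l) = c (i, k)"
      proof (rule eq_of_coloring_rank_le_projection[where X = ?X and d = d1 and e = "d1 + d2"
            and r = r and p = "\<lambda>(i, l). p i"])
        \<comment> \<open>\<open>p\<close> attains the maximal rank of \<open>G\<close>, which is
          assumed equal to that of the product, so \<open>c\<close> cannot have larger rank.\<close>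
        show "coloring_rank ?X (d1 + d2) c \<le> coloring_rank ?X d1 (\<lambda>(i, l). p i)"
          using coloring_rank_le_max[OF X c] eq rank_left by simp
        show "c w $ m = r * (case w of (i, l) \<Rightarrow> p i) $ m" if "w \<in> pverts ?X" "m < d1" for w m
          using that carrier_vecD[OF pcar] carrier_vecD[OF qcar] by (auto simp: c_def)
        show "finite (pverts ?X)" by (rule pair_graph_arcs(1)[OF X])
      qed (use that r pcar ccar in auto)
      then have "r \<cdot>\<^sub>v q (i, l) = r \<cdot>\<^sub>v q (i, k)"
        using append_vec_eq[of "r \<cdot>\<^sub>v p i" d1 "r \<cdot>\<^sub>v p i"] pcar[OF that(1)] by (simp add: c_def)
      then have "(1 / r) \<cdot>\<^sub>v (r \<cdot>\<^sub>v q (i, l)) = (1 / r) \<cdot>\<^sub>v (r \<cdot>\<^sub>v q (i, k))" by simp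
      then show ?thesis using r(1) by (simp add: smult_smult_assoc)
    qed
    have "optimal_vector_coloring G d2 (\<lambda>i. q (i, l0))"
      by (rule fibre[OF q const])
    moreover have "same_Gram ?X q (\<lambda>(i, l). q (i, l0))"
      using const[OF _ _ l0] by (auto simp: same_Gram_def)
    ultimately show ?thesis
      unfolding induced_by_left_def by (intro exI[of _ d2] exI[of _ "\<lambda>i. q (i, l0)"]) simp
  qed
  moreover have "max_coloring_rank ?X = max_coloring_rank G"
    if ind: "\<forall>d q. optimal_vector_coloring ?X d q \<longrightarrow> induced_by_left G H q"
  proof -
    obtain d q where q: "optimal_vector_coloring ?X d q" "coloring_rank ?X d q = max_coloring_rank ?X"
      by (rule max_coloring_rank_attained[OF X])
    obtain d' p' where "same_Gram ?X q (\<lambda>(i, l). p' i)"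
      using ind q(1) unfolding induced_by_left_def by blast
    then have gram: "q (i, l) \<bullet> q (j, k) = p' i \<bullet> p' j"
      if "i \<in> pverts G" "j \<in> pverts G" "l \<in> pverts H" "k \<in> pverts H" for i l j k
      using that by (simp add: same_Gram_def)
    \<comment> \<open>Equal inner products within a fibre force equal vectors. The rank of
      \<open>q\<close> is thus the rank of its own fibre over \<open>l0\<close>, in the same
      dimension \<open>d\<close>, without comparing ranks with \<open>p'\<close>.\<close>
    have const: "q (i, l) = q (i, k)" if "i \<in> pverts G" "l \<in> pverts H" "k \<in> pverts H" for i l k
      using that q(1)
      by (intro scalar_prod_eq_imp_eq[where d = d])
        (simp_all add: gram optimal_vector_coloring_def vector_coloring_def)
    have "optimal_vector_coloring G d (\<lambda>i. q (i, l0))"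
      by (rule fibre[OF q(1) const])
    from coloring_rank_le_max[OF assms(1) this] have "max_coloring_rank ?X \<le> max_coloring_rank G"
      using coloring_rank_product_left[where q = q and p = "\<lambda>i. q (i, l0)", OF ne const[OF _ _ l0]] q(2)
      by metis
    with ge show ?thesis by simp
  qed
  ultimately show ?thesis using ge by blast
qed

end
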